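(* (1) For $m,n,k\in\mathbb{N}$ with ($m=0$ or $n=0$) and $ma+nb+kc\in\Lambda^{1,1,2}_{+}$: \[ \mathcal{F}(ma+nb+kc;\Lambda^{1,1,2})\simeq\begin{cases} S^{-1} & \text{if } m=n=0,\ k=1,\\ S^{k-2}\vee S^{k-2} & \text{if } m=n=0,\ k\ge 2,\\ S^{k-1} & \text{if } (m,n)=(1,0) \text{ or } (0,1),\\ \mathrm{pt} & \text{otherwise.}\end{cases}\] (2) For $m,n,k\in\mathbb{N}$ with ($m=0$ or $n\le 1$) and $ma+nb+kc\in\Lambda^{1,2,2}_{+}$: $\mathcal{F}(ma+nb+kc;\Lambda^{1,2,2})\simeq S^{m+n+k-2}$ if $m\le 1$ and $n\le 1$, and $\simeq\mathrm{pt}$ otherwise. (3) For $m,n,k\in\mathbb{N}$ with ($m\le 1$ or $n\le 1$) and $ma+nb+kc\in\Lambda^{2,2,2}_{+}$: $\mathcal{F}(ma+nb+kc;\Lambda^{2,2,2})\simeq S^{m+n+k-2}$ if $m\le 1$ and $n\le 1$, and $\simeq\mathrm{pt}$ otherwise.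
   Context: $\mathbb{N}=\{0,1,2,\dots\}$. For an additive commutative monoid $\Lambda$ that is cancellative and has no non-trivial invertible elements, define the partial order $\lambda \le \mu$ iff there is $\nu\in\Lambda$ with $\lambda+\nu=\mu$; $\lambda<\mu$ means $\lambda\le\mu$, $\lambda\ne\mu$. Let $\Lambda_+=\Lambda\setminus\{0\}$. For a poset $P$, $|P|$ is the geometric realization of its order complex and $(x,y)_P=\{z\in P:x<z<y\}$. The Frobenius complex is $\mathcal{F}(\lambda;\Lambda)=|(0,\lambda)_\Lambda|$ for $\lambda\in\Lambda_+$. For positive integers $p,q,r$, $\Lambda^{p,q,r}=\langle a,b,c\mid pa+qb=rc\rangle$ is the quotient of the free commutative monoid $\mathbb{N}a\oplus\mathbb{N}b\oplus\mathbb{N}c$ by the congruence generated by $\lambda+pa+qb\sim\lambda+rc$. $S^n$ is the $n$-sphere, $S^{-1}$ the empty space, $\vee$ the wedge sum, $\mathrm{pt}$ the one-point space, $\simeq$ homotopy equivalence. *)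

theory Defs
  imports "HOL-Analysis.Analysis"
begin

section \<open>The monoid Lambda^{p,q,r} = <a,b,c | pa + qb = rc>\<close>

text \<open>Elements of the free commutative monoid Na + Nb + Nc are triples (m,n,k) = ma+nb+kc.
  One generating step of the congruence: lambda + pa + qb  ~  lambda + rc.\<close>

definition pres_step :: "nat \<Rightarrow> nat \<Rightarrow> nat \<Rightarrow> nat \<times> nat \<times> nat \<Rightarrow> nat \<times> nat \<times> nat \<Rightarrow> bool" where
  "pres_step p q r u v \<longleftrightarrow> (\<exists>x y z. u = (x + p, y + q, z) \<and> v = (x, y, z + r))"

text \<open>The congruence generated by the relations (reflexive, symmetric, transitive closure of
  the translation-invariant steps; this is automatically a congruence).\<close>

definition pres_cong :: "nat \<Rightarrow> nat \<Rightarrow> nat \<Rightarrow> nat \<times> nat \<times> nat \<Rightarrow> nat \<times> nat \<times> nat \<Rightarrow> bool" where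
  "pres_cong p q r = (symclp (pres_step p q r))\<^sup>*\<^sup>*"

definition cls :: "nat \<Rightarrow> nat \<Rightarrow> nat \<Rightarrow> nat \<times> nat \<times> nat \<Rightarrow> (nat \<times> nat \<times> nat) set" where
  "cls p q r u = {v. pres_cong p q r u v}"

definition Lam :: "nat \<Rightarrow> nat \<Rightarrow> nat \<Rightarrow> (nat \<times> nat \<times> nat) set set" where
  "Lam p q r = range (cls p q r)"

definition lam_le :: "nat \<Rightarrow> nat \<Rightarrow> nat \<Rightarrow> (nat \<times> nat \<times> nat) set \<Rightarrow> (nat \<times> nat \<times> nat) set \<Rightarrow> bool" where
  "lam_le p q r A B \<longleftrightarrow>
     (\<exists>x y z x' y' z'. A = cls p q r (x, y, z) \<and> B = cls p q r (x + x', y + y', z + z'))"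

definition lam_lt :: "nat \<Rightarrow> nat \<Rightarrow> nat \<Rightarrow> (nat \<times> nat \<times> nat) set \<Rightarrow> (nat \<times> nat \<times> nat) set \<Rightarrow> bool" where
  "lam_lt p q r A B \<longleftrightarrow> lam_le p q r A B \<and> A \<noteq> B"

text \<open>Points are convex combinations of the vertices of a chain, i.e. functions P -> [0,1]
  whose support is a finite nonempty chain and whose values sum to 1, topologized as a
  subspace of the product R^UNIV (for finite P this is the usual realization).\<close>

definition order_complex_real :: "'a set \<Rightarrow> ('a \<Rightarrow> 'a \<Rightarrow> bool) \<Rightarrow> ('a \<Rightarrow> real) topology" where
  "order_complex_real P le = subtopology (powertop_real UNIV)
     {f. (\<forall>x. 0 \<le> f x) \<and> {x. f x \<noteq> 0} \<subseteq> P \<and> finite {x. f x \<noteq> 0}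
         \<and> (\<forall>x\<in>{x. f x \<noteq> 0}. \<forall>y\<in>{x. f x \<noteq> 0}. le x y \<or> le y x)
         \<and> (\<Sum>x\<in>{x. f x \<noteq> 0}. f x) = 1}"

definition open_interval_Lam :: "nat \<Rightarrow> nat \<Rightarrow> nat \<Rightarrow> (nat \<times> nat \<times> nat) set \<Rightarrow> (nat \<times> nat \<times> nat) set set" where
  "open_interval_Lam p q r L =
     {M \<in> Lam p q r. lam_lt p q r (cls p q r (0, 0, 0)) M \<and> lam_lt p q r M L}"

definition frobenius_complex :: "nat \<Rightarrow> nat \<Rightarrow> nat \<Rightarrow> (nat \<times> nat \<times> nat) set
    \<Rightarrow> ((nat \<times> nat \<times> nat) set \<Rightarrow> real) topology" where
  "frobenius_complex p q r L = order_complex_real (open_interval_Lam p q r L) (lam_le p q r)"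

text \<open>S^d for integer d >= -1, with S^{-1} the empty space.\<close>

definition sphere_sp :: "int \<Rightarrow> (nat \<Rightarrow> real) topology" where
  "sphere_sp d = (if d < 0 then trivial_topology else nsphere (nat d))"

text \<open>S^d \<or> S^d (d >= 0), modelled as two d-spheres of radius 1 in R^{d+1} centred at
  e_0 and -e_0, touching exactly at the origin.\<close>

definition wedge_two_spheres :: "nat \<Rightarrow> (nat \<Rightarrow> real) topology" where
  "wedge_two_spheres d = subtopology (powertop_real UNIV)
     {x. (\<forall>i>d. x i = 0) \<and>
         ((x 0 - 1)\<^sup>2 + (\<Sum>i\<in>{1..d}. (x i)\<^sup>2) = 1 \<or> (x 0 + 1)\<^sup>2 + (\<Sum>i\<in>{1..d}. (x i)\<^sup>2) = 1)}"

definition pt_space :: "unit topology" where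
  "pt_space = discrete_topology {()}"

end

theory Submission
  imports Defs
begin

text \<open>
  Throughout \<open>r = 2\<close>. If \<open>c < \<lambda>\<close> and \<open>\<lambda> \<noteq> a + b\<close>, then the open interval below \<open>\<lambda>\<close> without
  the coatom \<open>\<lambda> - c\<close> is contractible, because each of its elements lies below \<open>\<lambda> - a\<close> or
  \<open>\<lambda> - b\<close>, and those below both are exactly those below \<open>\<lambda> - a - b\<close>. Restoring \<open>\<lambda> - c\<close>
  glues a cone over the interval below \<open>\<lambda> - c\<close>, so the Frobenius complex of \<open>\<lambda>\<close> is the
  suspension of that of \<open>\<lambda> - c\<close>. The suspensions are kept combinatorial, as ordinal sums with
  two-element antichains placed on top. This reduces everything to \<open>\<lambda> = ma + nb\<close>, to \<open>c\<close> and,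
  in the case \<open>p = q = 1\<close>, to \<open>2c = a + b\<close>, where the interval consists of the three points
  \<open>a, b, c\<close>.
\<close>

section \<open>Realizations of finite posets\<close>

text \<open>The conditions on \<open>m\<close> and \<open>n\<close> in the three parts all say that
  \<open>m < p\<close> or \<open>n < q\<close>. Then pa + qb does not fit below ma + nb, so no
  element below ma + nb involves c, and the interval is a grid without two opposite corners. This is
  why the descent ends in something computable. The value a + b is an obstacle because there
  \<lambda> - a - b is 0, which is not in the open interval, so the contraction loses its apex. As c
  < a + b forces p = q = 1, the obstacle is met only there, on the way down from kc; the descent has
  to stop one step early, and the three incomparable points found there, a wedge of two 0-spheres,
  are the source of the wedge. Keeping the suspensions combinatorial means that every step of the
  descent compares two finite posets. Each added antichain lies above the whole base, so an argument
  about the base extends to the tower. Euclidean models enter only for the final bases: empty, two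
  points or three points. The number of added antichains is the number of c removed, which gives the
  summand \<open>k\<close> of the dimension.\<close>

definition supp :: "('a \<Rightarrow> real) \<Rightarrow> 'a set" where
  "supp f = {x. f x \<noteq> 0}"

definition is_chain :: "('a \<Rightarrow> 'a \<Rightarrow> bool) \<Rightarrow> 'a set \<Rightarrow> bool" where
  "is_chain le A \<longleftrightarrow> (\<forall>x\<in>A. \<forall>y\<in>A. le x y \<or> le y x)"

text \<open>Weights are summed over \<open>P\<close> and not over the support: for finite
  \<open>P\<close> the value is the same, but it is linear and continuous in
  \<open>f\<close>.\<close>

definition realization :: "'a set \<Rightarrow> ('a \<Rightarrow> 'a \<Rightarrow> bool) \<Rightarrow> ('a \<Rightarrow> real) set" where
  "realization P le = {f. (\<forall>x. 0 \<le> f x) \<and> supp f \<subseteq> P \<and> is_chain le (supp f) \<and> sum f P = 1}"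

definition normalize_on :: "'a set \<Rightarrow> ('a \<Rightarrow> real) \<Rightarrow> 'a \<Rightarrow> real" where
  "normalize_on P f = (\<lambda>x. f x / sum f P)"

lemma is_chain_subset: "is_chain le B \<Longrightarrow> A \<subseteq> B \<Longrightarrow> is_chain le A"
  unfolding is_chain_def by blast

lemma order_complex_real_eq_realization:
  assumes "finite P"
  shows "order_complex_real P le = top_of_set (realization P le)"
proof -
  have "sum f P = sum f {x. f x \<noteq> 0}" if "{x. f x \<noteq> 0} \<subseteq> P" for f :: "'a \<Rightarrow> real"
    using assms that by (intro sum.mono_neutral_right) auto
  moreover have "finite {x. f x \<noteq> 0}" if "{x. f x \<noteq> 0} \<subseteq> P" for f :: "'a \<Rightarrow> real"
    using assms that finite_subset by blast
  ultimately have "realization P le = {f. (\<forall>x. 0 \<le> f x) \<and> {x. f x \<noteq> 0} \<subseteq> P \<and> finite {x. f x \<noteq> 0}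
         \<and> (\<forall>x\<in>{x. f x \<noteq> 0}. \<forall>y\<in>{x. f x \<noteq> 0}. le x y \<or> le y x)
         \<and> (\<Sum>x\<in>{x. f x \<noteq> 0}. f x) = 1}"
    unfolding realization_def supp_def is_chain_def by auto
  then show ?thesis
    unfolding order_complex_real_def by (simp add: euclidean_product_topology)
qed

lemma sum_pos_of_supp:
  assumes "finite P" "\<And>x. 0 \<le> f x" "x \<in> P" "f x \<noteq> (0::real)"
  shows "sum f P > 0"
  using assms by (metis less_eq_real_def sum_nonneg_eq_0_iff sum_nonneg)

lemma supp_normalize_on: "sum f P \<noteq> 0 \<Longrightarrow> supp (normalize_on P f) = supp f"
  by (auto simp: supp_def normalize_on_def)

lemma normalize_on_in_realization:
  assumes "\<And>x. 0 \<le> f x" "supp f \<subseteq> P" "is_chain le (supp f)" "sum f P \<noteq> 0"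
  shows "normalize_on P f \<in> realization P le"
proof -
  have "sum f P \<ge> 0" using assms(1) by (simp add: sum_nonneg)
  then show ?thesis
    using assms supp_normalize_on[OF assms(4)]
    by (auto simp: realization_def normalize_on_def sum_divide_distrib[symmetric])
qed

lemma continuous_on_normalize_on:
  assumes "\<And>x. continuous_on S (\<lambda>s. g s x)" "\<And>s. s \<in> S \<Longrightarrow> sum (g s) P \<noteq> 0"
  shows "continuous_on S (\<lambda>s. normalize_on P (g s))"
  unfolding normalize_on_def
  by (intro continuous_on_coordinatewise_then_product continuous_on_divide continuous_on_sum assms ballI)

section \<open>Homotopies between maps into a realization\<close>

lemma homotopy_equivalent_top_of_setI:
  assumes "continuous_on S f" "f \<in> S \<rightarrow> T" "continuous_on T g" "g \<in> T \<rightarrow> S"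
    and "homotopic_with_canon (\<lambda>_. True) S S (g \<circ> f) id"
    and "homotopic_with_canon (\<lambda>_. True) T T (f \<circ> g) id"
  shows "top_of_set S homotopy_equivalent_space top_of_set T"
  unfolding homotopy_equivalent_space_def using assms by (auto simp: Pi_iff image_subset_iff)

lemma homotopic_with_canon_cong:
  assumes "continuous_on S f" "f \<in> S \<rightarrow> T" "\<And>x. x \<in> S \<Longrightarrow> f x = g x"
  shows "homotopic_with_canon (\<lambda>_. True) S T f g"
  using assms by (intro homotopic_with_equal) auto

lemma homotopic_with_canonI:
  assumes "continuous_on ({0..1::real} \<times> S) G" "G \<in> {0..1} \<times> S \<rightarrow> T"
    and "\<And>x. x \<in> S \<Longrightarrow> G (0, x) = f x" "\<And>x. x \<in> S \<Longrightarrow> G (1, x) = g x"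
  shows "homotopic_with_canon (\<lambda>_. True) S T f g"
proof -
  have "\<exists>h. continuous_map (prod_topology (top_of_set {0..1::real}) (top_of_set S)) (top_of_set T) h \<and>
      (\<forall>x\<in>S. h (0, x) = f x) \<and> (\<forall>x\<in>S. h (1, x) = g x)"
    using assms by (intro exI[of _ G]) (auto simp: Pi_iff image_subset_iff)
  then show ?thesis by (subst homotopic_with) auto
qed

text \<open>The straight-line homotopy stays inside the complex.\<close>

lemma contiguous_homotopic:
  assumes "continuous_on S g" "continuous_on S h"
    and gh: "g \<in> S \<rightarrow> realization P le" "h \<in> S \<rightarrow> realization P le"
    and chain: "\<And>s. s \<in> S \<Longrightarrow> is_chain le (supp (g s) \<union> supp (h s))"
  shows "homotopic_with_canon (\<lambda>_. True) S (realization P le) g h"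
proof -
  define G where "G = (\<lambda>(t::real, s). (\<lambda>x. (1 - t) * g s x + t * h s x))"
  have gc: "continuous_on ({0..1} \<times> S) (\<lambda>z::real \<times> _. g (snd z) x)" for x
    using continuous_on_product_then_coordinatewise[OF assms(1)]
    by (rule continuous_on_compose2) (auto intro: continuous_intros)
  have hc: "continuous_on ({0..1} \<times> S) (\<lambda>z::real \<times> _. h (snd z) x)" for x
    using continuous_on_product_then_coordinatewise[OF assms(2)]
    by (rule continuous_on_compose2) (auto intro: continuous_intros)
  have "continuous_on ({0..1} \<times> S) G"
    unfolding G_def case_prod_unfold
    by (intro continuous_on_coordinatewise_then_product continuous_intros gc hc)
  moreover have "G (t, s) \<in> realization P le" if "t \<in> {0..1}" "s \<in> S" for t s
  proof -
    have g: "g s \<in> realization P le" and h: "h s \<in> realization P le" using gh that by auto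
    have sub: "supp (G (t, s)) \<subseteq> supp (g s) \<union> supp (h s)"
      by (auto simp: supp_def G_def)
    have "sum (G (t, s)) P = 1"
      using g h by (simp add: G_def realization_def sum.distrib sum_distrib_left[symmetric])
    then show ?thesis
      using g h sub chain[OF \<open>s \<in> S\<close>] that
      by (auto simp: realization_def G_def intro: is_chain_subset)
  qed
  ultimately show ?thesis
    by (intro homotopic_with_canonI[of S G]) (auto simp: G_def)
qed

lemma continuous_on_coordinate [continuous_intros]: "continuous_on S (\<lambda>f :: 'a \<Rightarrow> real. f x)"
  by (rule continuous_on_subset[OF continuous_on_product_coordinates]) simp

lemma continuous_on_coordinate_snd [continuous_intros]:
  "continuous_on S (\<lambda>z :: 'b::topological_space \<times> ('a \<Rightarrow> real). snd z x)"
  by (rule continuous_on_compose2[OF continuous_on_coordinate[of UNIV x]])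
    (auto intro: continuous_intros)

lemma continuous_on_if_const:
  assumes "b \<Longrightarrow> continuous_on S f" "\<not> b \<Longrightarrow> continuous_on S g"
  shows "continuous_on S (\<lambda>x. if b then f x else g x)"
  using assms by (cases b) auto

section \<open>Simplicial maps: retractions, cones and isomorphisms\<close>

definition pushforward :: "'a set \<Rightarrow> ('a \<Rightarrow> 'b) \<Rightarrow> ('a \<Rightarrow> real) \<Rightarrow> 'b \<Rightarrow> real" where
  "pushforward M e f z = (\<Sum>y\<in>M. if e y = z then f y else 0)"

lemma supp_pushforward: "supp (pushforward M e f) \<subseteq> e ` supp f"
proof
  fix z assume "z \<in> supp (pushforward M e f)"
  then obtain y where "(if e y = z then f y else 0) \<noteq> 0"
    unfolding supp_def pushforward_def using sum.not_neutral_contains_not_neutral by blast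
  then show "z \<in> e ` supp f" by (auto simp: supp_def split: if_splits)
qed

lemma sum_pushforward:
  assumes "finite M" "finite N" "\<And>x. x \<in> M \<Longrightarrow> e x \<in> N"
  shows "sum (pushforward M e f) N = sum f M"
  unfolding pushforward_def using assms by (subst sum.swap) simp

lemma continuous_on_pushforward: "continuous_on S (pushforward M e)"
proof -
  have "continuous_on S (\<lambda>f. pushforward M e f z)" for z
    unfolding pushforward_def by (intro continuous_on_sum) (intro continuous_on_if_const continuous_on_coordinate continuous_on_const)
  then show ?thesis by (rule continuous_on_coordinatewise_then_product)
qed

lemma realization_mono: "finite M \<Longrightarrow> N \<subseteq> M \<Longrightarrow> realization N le \<subseteq> realization M le"
proof
  fix f assume "finite M" "N \<subseteq> M" and f: "f \<in> realization N le"
  moreover have "sum f M = sum f N"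
    using \<open>finite M\<close> \<open>N \<subseteq> M\<close> f by (intro sum.mono_neutral_right) (auto simp: realization_def supp_def)
  ultimately show "f \<in> realization M le" by (auto simp: realization_def)
qed

text \<open>By \<open>cmp\<close>, a chain together with its image under \<open>e\<close> is again a
  chain (the case \<open>x = y\<close> covers the pair \<open>x\<close>, \<open>e x\<close>). Hence
  the simplicial map induced by \<open>e\<close> is contiguous to the identity.\<close>

lemma realization_retract:
  assumes fin: "finite M" and NM: "N \<subseteq> M"
    and eN: "\<And>x. x \<in> M \<Longrightarrow> e x \<in> N" and id: "\<And>x. x \<in> N \<Longrightarrow> e x = x"
    and cmp: "\<And>x y. x \<in> M \<Longrightarrow> y \<in> M \<Longrightarrow> le x y \<Longrightarrow>
        (le (e x) y \<or> le y (e x)) \<and> (le x (e y) \<or> le (e y) x) \<and> (le (e x) (e y) \<or> le (e y) (e x))"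
  shows "top_of_set (realization M le) homotopy_equivalent_space top_of_set (realization N le)"
proof -
  let ?F = "pushforward M e"
  have chain: "is_chain le (C \<union> e ` C)" if "is_chain le C" "C \<subseteq> M" for C
    using that unfolding is_chain_def by (auto; meson cmp subsetD)
  have F: "?F f \<in> realization N le" if "f \<in> realization M le" for f
  proof -
    have "is_chain le (supp f \<union> e ` supp f)"
      using that by (intro chain) (auto simp: realization_def)
    then have "is_chain le (supp (?F f))"
      by (rule is_chain_subset) (use supp_pushforward in fastforce)
    moreover have "supp (?F f) \<subseteq> N"
      using supp_pushforward[of M e f] that eN by (auto simp: realization_def)
    moreover have "sum (?F f) N = 1"
      using sum_pushforward[of M N e f] fin NM eN that finite_subset by (auto simp: realization_def)
    moreover have "0 \<le> ?F f x" for x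
      using that by (auto simp: realization_def pushforward_def intro!: sum_nonneg)
    ultimately show ?thesis by (simp add: realization_def)
  qed
  have FN: "?F f = f" if "f \<in> realization N le" for f
  proof
    fix z
    have "?F f z = (\<Sum>y\<in>N. if e y = z then f y else 0)"
      unfolding pushforward_def using fin NM that
      by (intro sum.mono_neutral_right) (auto simp: realization_def supp_def)
    also have "\<dots> = (\<Sum>y\<in>N. if y = z then f y else 0)"
      by (intro sum.cong) (auto simp: id)
    also have "\<dots> = f z"
      using that finite_subset[OF NM fin] by (auto simp: realization_def supp_def)
    finally show "?F f z = f z" .
  qed
  note sub = realization_mono[OF fin NM, of le]
  show ?thesis
  proof (rule homotopy_equivalent_top_of_setI)
    show "continuous_on (realization M le) ?F" by (rule continuous_on_pushforward)
    show "?F \<in> realization M le \<rightarrow> realization N le" using F by auto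
    show "id \<in> realization N le \<rightarrow> realization M le" using sub by auto
    show "homotopic_with_canon (\<lambda>_. True) (realization M le) (realization M le) (id \<circ> ?F) id"
    proof (rule contiguous_homotopic)
      show "is_chain le (supp ((id \<circ> ?F) s) \<union> supp (id s))" if "s \<in> realization M le" for s
      proof (rule is_chain_subset[OF chain[of "supp s"]])
        show "supp ((id \<circ> ?F) s) \<union> supp (id s) \<subseteq> supp s \<union> e ` supp s"
          using supp_pushforward[of M e s] by auto
      qed (use that in \<open>auto simp: realization_def\<close>)
    qed (use F sub in \<open>auto intro: continuous_on_pushforward\<close>)
    show "homotopic_with_canon (\<lambda>_. True) (realization N le) (realization N le) (?F \<circ> id) id"
      using FN by (intro homotopic_with_canon_cong) (auto intro: continuous_on_pushforward)
  qed (auto intro: continuous_on_id)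
qed

lemma vertex_in_realization:
  assumes "finite P" "p \<in> P" "le p p"
  shows "(\<lambda>x. if x = p then 1 else 0) \<in> realization P le"
  using assms by (auto simp: realization_def supp_def is_chain_def)

text \<open>A chain stays a chain when the apex \<open>p\<close> is added, so the identity is
  contiguous to the constant map at the vertex \<open>p\<close>.\<close>

lemma contractible_realization_cone:
  assumes "finite P" "p \<in> P" and cmp: "\<And>y. y \<in> P \<Longrightarrow> le p y \<or> le y p"
  shows "contractible (realization P le)"
proof -
  let ?d = "\<lambda>x. if x = p then 1 else (0::real)"
  have "le p p" using assms by blast
  then have d: "?d \<in> realization P le" by (intro vertex_in_realization assms)
  have "homotopic_with_canon (\<lambda>_. True) (realization P le) (realization P le) id (\<lambda>_. ?d)"
  proof (rule contiguous_homotopic)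
    show "is_chain le (supp (id s) \<union> supp ?d)" if "s \<in> realization P le" for s
      using that cmp \<open>le p p\<close> by (auto simp: is_chain_def realization_def supp_def subset_iff)
  qed (use d in \<open>auto intro: continuous_on_id continuous_on_const\<close>)
  then show ?thesis unfolding contractible_def by blast
qed

lemma realization_iso:
  assumes fin: "finite P" and bij: "bij_betw \<phi> P Q"
    and mono: "\<And>x y. x \<in> P \<Longrightarrow> y \<in> P \<Longrightarrow> le x y \<longleftrightarrow> le' (\<phi> x) (\<phi> y)"
  shows "top_of_set (realization P le) homotopy_equivalent_space top_of_set (realization Q le')"
proof -
  define \<psi> where "\<psi> = inv_into P \<phi>"
  have \<psi>: "\<And>x. x \<in> P \<Longrightarrow> \<psi> (\<phi> x) = x" "\<And>y. y \<in> Q \<Longrightarrow> \<phi> (\<psi> y) = y" "\<And>y. y \<in> Q \<Longrightarrow> \<psi> y \<in> P"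
    "\<And>x. x \<in> P \<Longrightarrow> \<phi> x \<in> Q"
    using bij unfolding \<psi>_def
    by (auto simp: bij_betw_def f_inv_into_f inv_into_into)
  let ?F = "\<lambda>f z. if z \<in> Q then f (\<psi> z) else (0::real)"
  let ?G = "\<lambda>f z. if z \<in> P then f (\<phi> z) else (0::real)"
  have bij': "bij_betw \<psi> Q P" unfolding \<psi>_def by (rule bij_betw_inv_into[OF bij])
  have F: "?F f \<in> realization Q le'" if f: "f \<in> realization P le" for f
  proof -
    have "is_chain le' (supp (?F f))"
      using f mono[of "\<psi> _" "\<psi> _"] \<psi> unfolding realization_def is_chain_def supp_def
      by (auto split: if_splits) metis
    moreover have "sum (?F f) Q = 1"
      using f sum.reindex_bij_betw[OF bij', of f] by (auto simp: realization_def)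
    ultimately show ?thesis using f by (auto simp: realization_def supp_def split: if_splits)
  qed
  have G: "?G f \<in> realization P le" if f: "f \<in> realization Q le'" for f
  proof -
    have "is_chain le (supp (?G f))"
      using f mono \<psi> unfolding realization_def is_chain_def supp_def
      by (auto split: if_splits)
    moreover have "sum (?G f) P = 1"
      using f sum.reindex_bij_betw[OF bij, of f] by (auto simp: realization_def)
    ultimately show ?thesis using f by (auto simp: realization_def supp_def split: if_splits)
  qed
  have FG: "?F (?G f) = f" if "f \<in> realization Q le'" for f
    using that \<psi> by (auto simp: realization_def supp_def fun_eq_iff)
  have GF: "?G (?F f) = f" if "f \<in> realization P le" for f
    using that \<psi> by (auto simp: realization_def supp_def fun_eq_iff)
  have cF: "continuous_on S ?F" for S
    by (intro continuous_on_coordinatewise_then_product continuous_on_if_const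
        continuous_on_coordinate continuous_on_const)
  have cG: "continuous_on S ?G" for S
    by (intro continuous_on_coordinatewise_then_product continuous_on_if_const
        continuous_on_coordinate continuous_on_const)
  have cGF: "continuous_on S (?G \<circ> ?F)" and cFG: "continuous_on T (?F \<circ> ?G)" for S T
    using cF cG continuous_on_compose by blast+
  show ?thesis
  proof (rule homotopy_equivalent_top_of_setI[of _ ?F _ ?G])
    show "homotopic_with_canon (\<lambda>_. True) (realization P le) (realization P le) (?G \<circ> ?F) id"
      by (intro homotopic_with_canon_cong cGF) (use GF in auto)
    show "homotopic_with_canon (\<lambda>_. True) (realization Q le') (realization Q le') (?F \<circ> ?G) id"
      by (intro homotopic_with_canon_cong cFG) (use FG in auto)
  qed (use F G cF cG in auto)
qed

section \<open>Deleting a vertex with contractible link\<close>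

lemma continuous_on_closed_Un3:
  assumes U: "U = A \<union> B \<union> C"
    and cl: "closedin (top_of_set U) A" "closedin (top_of_set U) B" "closedin (top_of_set U) C"
    and f: "continuous_on A f" "continuous_on B f" "continuous_on C f"
  shows "continuous_on U f"
proof -
  have "closedin (top_of_set (A \<union> B)) A" "closedin (top_of_set (A \<union> B)) B"
    using cl U by (auto intro: closedin_subset_trans)
  then have "continuous_on (A \<union> B) f"
    using f by (intro continuous_on_Un_local)
  moreover have "closedin (top_of_set U) (A \<union> B)" using cl by (intro closedin_Un)
  ultimately show ?thesis using cl f unfolding U by (metis continuous_on_Un_local)
qed

text \<open>The open star of \<open>v\<close> is a cone over its link. A contraction of the link, run for a time
  proportional to the weight of \<open>v\<close>, pushes this cone into the link.\<close>

lemma realization_delete: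
  assumes fin: "finite M" and vM: "v \<in> M" and vv: "le v v"
    and Q: "Q = {y \<in> M. y \<noteq> v \<and> (le y v \<or> le v y)}"
    and contr: "contractible (realization Q le)" and ne: "realization Q le \<noteq> {}"
  shows "realization M le homotopy_eqv realization (M - {v}) le"
proof -
  define R where "R = realization M le"
  define RP where "RP = realization (M - {v}) le"
  define RQ where "RQ = realization Q le"
  have QM: "Q \<subseteq> M" "v \<notin> Q" "finite Q" using Q fin by auto
  have finP: "finite (M - {v})" using fin by auto
  have QR: "RQ \<subseteq> R" "RQ \<subseteq> RP" "RP \<subseteq> R"
    unfolding R_def RP_def RQ_def using QM by (intro realization_mono fin finP; blast)+
  obtain p where hom: "homotopic_with_canon (\<lambda>_. True) RQ RQ id (\<lambda>_. p)"
    using contr unfolding contractible_def RQ_def by blast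
  \<comment> \<open>\<open>contractible\<close> holds of the empty set as well; the assumption
    \<open>ne\<close> is what places the end point \<open>p\<close> of the contraction in the
    link.\<close>
  have p: "p \<in> RQ"
    using homotopic_with_imp_subset2[OF hom] ne RQ_def by fastforce
  obtain H where Hc: "continuous_on ({0..1::real} \<times> RQ) H" and HQ: "\<And>t q. t \<in> {0..1} \<Longrightarrow> q \<in> RQ \<Longrightarrow> H (t, q) \<in> RQ"
    and H0: "\<And>q. H (0, q) = q" and H1: "\<And>q. H (1, q) = p"
    using hom unfolding homotopic_with_def by (auto simp: Pi_iff)
  \<comment> \<open>Radial projection away from \<open>v\<close> onto the link, which makes no sense
    at the vertex \<open>v\<close> itself. The cut at weight 1/2 avoids that vertex: on
    \<open>S2\<close> at least half of the weight lies on the link, while \<open>S3\<close> is the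
    part near \<open>v\<close>.\<close>
  define q where "q y = normalize_on Q (y(v := 0))" for y :: "'a \<Rightarrow> real"
  define S1 where "S1 = {y \<in> R. y v = 0}"
  define S2 where "S2 = {y \<in> R. y v \<le> 1/2 \<and> (\<forall>x. x \<notin> insert v Q \<longrightarrow> y x = 0)}"
  define S3 where "S3 = {y \<in> R. y v \<ge> 1/2}"
  have sumM: "sum y M = y v + sum y (M - {v})" for y :: "'a \<Rightarrow> real"
    by (rule sum.remove[OF fin vM])
  have R_Q: "y x = 0" if "y \<in> R" "y v \<noteq> 0" "x \<notin> insert v Q" for y x
    using that unfolding R_def realization_def is_chain_def supp_def Q by auto
  have R_S: "R = S1 \<union> S2 \<union> S3"
    unfolding S1_def S2_def S3_def using R_Q by force
  have sumQ: "sum (y(v := 0)) Q = 1 - y v" if "y \<in> S2" for y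
  proof -
    have "sum (y(v := 0)) Q = sum y (M - {v})"
    proof (rule sum.mono_neutral_cong_left)
      show "\<forall>x\<in>M - {v} - Q. y x = 0" using that by (auto simp: S2_def)
    qed (use QM finP in auto)
    also have "\<dots> = 1 - y v" using that sumM[of y] by (simp add: S2_def R_def realization_def)
    finally show ?thesis .
  qed
  have sumQ0: "sum (y(v := 0)) Q \<noteq> 0" if "y \<in> S2" for y
    using sumQ[OF that] that by (auto simp: S2_def)
  have supp_q: "supp (q y) = supp y - {v}" if "y \<in> S2" for y
    unfolding q_def supp_normalize_on[OF sumQ0[OF that]] by (auto simp: supp_def)
  have qQ: "q y \<in> RQ" if "y \<in> S2" for y
    unfolding q_def RQ_def
  proof (rule normalize_on_in_realization)
    have "is_chain le (supp y)" "supp y \<subseteq> insert v Q"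
      using that by (auto simp: S2_def R_def realization_def supp_def)
    moreover have "supp (y(v := 0)) \<subseteq> supp y - {v}" by (auto simp: supp_def)
    ultimately show "is_chain le (supp (y(v := 0)))" "supp (y(v := 0)) \<subseteq> Q"
      by (auto intro: is_chain_subset)
  qed (use that sumQ0 in \<open>auto simp: S2_def R_def realization_def\<close>)
  have q_id: "q y = y" if "y \<in> S1" "y \<in> S2" for y
  proof -
    have "y(v := 0) = y" using that by (auto simp: S1_def)
    then show ?thesis using sumQ[OF that(2)] that(1) unfolding q_def normalize_on_def
      by (auto simp: S1_def)
  qed
  have qc: "continuous_on S2 q"
    unfolding q_def
  proof (rule continuous_on_normalize_on)
    show "continuous_on S2 (\<lambda>y. (y(v := 0)) x)" for x
      by (cases "x = v") (auto intro: continuous_on_coordinate)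
  qed (rule sumQ0)
  \<comment> \<open>The time \<open>2 * y v\<close> is 0 where the star meets the rest of the
    complex, so \<open>r\<close> is the identity there, and it is 1 at the cut, where
    \<open>H\<close> has arrived at \<open>p\<close>. Thus the three formulas agree on the
    overlaps.\<close>
  define r where "r y = (if y \<in> S1 then y else if y \<in> S2 then H (2 * y v, q y) else p)" for y
  \<comment> \<open>A bridge from the identity to \<open>r\<close>: the weight of \<open>v\<close>
    is doubled while the link part follows \<open>H\<close>. At \<open>t = 0\<close> the point stays
    in the simplex of \<open>y\<close>; at \<open>t = 1\<close> it spans a simplex with
    \<open>r y\<close>. Both ends are therefore joined to the identity and to \<open>r\<close> by
    straight lines.\<close>
  define K where "K = (\<lambda>(t, y). if y \<in> S1 then y else if y \<in> S2
      then (\<lambda>x. (if x = v then 2 * y v else 0) + (1 - 2 * y v) * H (2 * y v * t, q y) x)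
      else (\<lambda>x. if x = v then 1 else 0))"
  have closed: "closedin (top_of_set R) S1" "closedin (top_of_set R) S2" "closedin (top_of_set R) S3"
  proof -
    have c: "closed {y :: 'a \<Rightarrow> real. y x = 0}" for x
      by (intro closed_Collect_eq continuous_on_coordinate continuous_on_const)
    have c2: "closed {y :: 'a \<Rightarrow> real. y v \<le> 1/2}" "closed {y :: 'a \<Rightarrow> real. 1/2 \<le> y v}"
      by (intro closed_Collect_le continuous_on_coordinate continuous_on_const)+
    have "S1 = R \<inter> {y. y v = 0}" "S3 = R \<inter> {y. 1/2 \<le> y v}"
      "S2 = R \<inter> ({y. y v \<le> 1/2} \<inter> (\<Inter>x\<in>-insert v Q. {y. y x = 0}))"
      by (auto simp: S1_def S2_def S3_def)
    then show "closedin (top_of_set R) S1" "closedin (top_of_set R) S2" "closedin (top_of_set R) S3"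
      using c c2 by (simp_all only:) (intro closedin_closed_Int closed_Int closed_INT ballI; simp)+
  qed
  have sv: "0 \<le> y v" if "y \<in> R" for y using that by (auto simp: R_def realization_def)
  have r1: "r y = y" if "y \<in> S1" for y using that by (simp add: r_def)
  have r2: "r y = H (2 * y v, q y)" if "y \<in> S2" for y
    using that q_id[of y] H0 by (auto simp: r_def S1_def)
  have r3: "r y = p" if "y \<in> S3" for y
  proof (cases "y \<in> S2")
    case True
    then have "2 * y v = 1" using that by (auto simp: S2_def S3_def)
    then show ?thesis using r2[OF True] H1 by simp
  qed (use that in \<open>auto simp: r_def S1_def S3_def\<close>)
  have K1: "K (t, y) = y" if "y \<in> S1" for t y using that by (simp add: K_def)
  have K2: "K (t, y) = (\<lambda>x. (if x = v then 2 * y v else 0) + (1 - 2 * y v) * H (2 * y v * t, q y) x)"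
    if "y \<in> S2" for t y
    using that q_id[of y] H0 by (auto simp: K_def S1_def)
  have K3: "K (t, y) = (\<lambda>x. if x = v then 1 else 0)" if "y \<in> S3" for t y
  proof (cases "y \<in> S2")
    case True
    then have "2 * y v = 1" using that by (auto simp: S2_def S3_def)
    then show ?thesis using K2[OF True] by auto
  qed (use that in \<open>auto simp: K_def S1_def S3_def\<close>)
  have rc: "continuous_on R r"
  proof -
    have "continuous_on S1 r"
      using continuous_on_cong[of S1 S1 r id] r1 by (simp add: continuous_on_id)
    moreover have "continuous_on S3 r"
      using continuous_on_cong[of S3 S3 r "\<lambda>_. p"] r3 by simp
    moreover have "continuous_on S2 r"
    proof -
      have "continuous_on S2 (\<lambda>y. H (2 * y v, q y))"
        by (rule continuous_on_compose2[OF Hc])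
          (use qc qQ sv in \<open>auto intro!: continuous_on_Pair continuous_on_mult continuous_on_coordinate
            continuous_on_const simp: S2_def\<close>)
      then show ?thesis using continuous_on_cong[of S2 S2 r] r2 by simp
    qed
    ultimately show ?thesis
      by (intro continuous_on_closed_Un3[OF R_S closed])
  qed
  have rRP: "r y \<in> RP" if "y \<in> R" for y
  proof -
    have "r y \<in> RP" if "y \<in> S1"
    proof -
      have "supp y \<subseteq> M - {v}" "sum y (M - {v}) = 1"
        using that sumM[of y] by (auto simp: S1_def R_def realization_def supp_def)
      then show ?thesis using that r1 by (auto simp: RP_def S1_def R_def realization_def)
    qed
    moreover have "r y \<in> RP" if "y \<in> S2"
      using that r2 HQ[of "2 * y v" "q y"] qQ QR sv[of y] by (auto simp: S2_def)
    moreover have "r y \<in> RP" if "y \<in> S3" using r3[OF that] p QR by auto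
    ultimately show ?thesis using R_S that by blast
  qed
  have r_id: "r y = y" if "y \<in> RP" for y
  proof -
    have "y \<in> S1" using that QR by (auto simp: S1_def RP_def realization_def supp_def)
    then show ?thesis by (rule r1)
  qed
  have vQ: "is_chain le (insert v (supp f))" if "f \<in> RQ" for f
    using that vv unfolding RQ_def realization_def is_chain_def Q by blast
  have KR: "K (t, y) \<in> R" if "t \<in> {0..1}" "y \<in> R" for t y
  proof -
    have "K (t, y) \<in> R" if "y \<in> S1" using that by (auto simp: K1 S1_def)
    moreover have "K (t, y) \<in> R" if "y \<in> S3"
      using that K3 vertex_in_realization[of M v le] fin vM vv by (auto simp: R_def)
    moreover have "K (t, y) \<in> R" if y: "y \<in> S2"
    proof -
      have s: "0 \<le> 2 * y v" "2 * y v \<le> 1" using y sv[of y] by (auto simp: S2_def)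
      define h where "h = H (2 * y v * t, q y)"
      have h: "h \<in> RQ"
        unfolding h_def using s \<open>t \<in> {0..1}\<close> by (intro HQ qQ y) (auto intro: mult_le_one)
      have hR: "h \<in> R" using h QR by blast
      have Kh: "K (t, y) = (\<lambda>x. (if x = v then 2 * y v else 0) + (1 - 2 * y v) * h x)"
        using K2[OF y] h_def by simp
      have "supp (K (t, y)) \<subseteq> insert v (supp h)" unfolding Kh by (auto simp: supp_def)
      moreover have "sum (K (t, y)) M = 1"
        unfolding Kh using fin vM hR
        by (simp add: sum.distrib sum_distrib_left[symmetric] R_def realization_def)
      ultimately show ?thesis
        using is_chain_subset[OF vQ[OF h]] hR vM s
        unfolding R_def realization_def by (auto simp: Kh)
    qed
    ultimately show ?thesis using R_S that by blast
  qed
  have Kc: "continuous_on ({0..1} \<times> R) K"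
  proof -
    have "continuous_on ({0..1} \<times> S1) K"
      by (rule continuous_on_eq[OF continuous_on_snd[OF continuous_on_id]]) (auto simp: K1)
    moreover have "continuous_on ({0..1} \<times> S3) K"
      by (rule continuous_on_eq[OF continuous_on_const]) (auto simp: K3)
    moreover have "continuous_on ({0..1} \<times> S2) K"
    proof -
      have "continuous_on ({0..1} \<times> S2) (\<lambda>z. H (2 * snd z v * fst z, q (snd z)))"
      proof (rule continuous_on_compose2[OF Hc])
        show "continuous_on ({0..1} \<times> S2) (\<lambda>z. (2 * snd z v * fst z, q (snd z)))"
          by (intro continuous_on_Pair continuous_intros continuous_on_compose2[OF qc]) auto
        show "(\<lambda>z. (2 * snd z v * fst z, q (snd z))) ` ({0..1} \<times> S2) \<subseteq> {0..1} \<times> RQ"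
        proof (rule image_subsetI)
          fix z assume "z \<in> {0..1::real} \<times> S2"
          then obtain t y where z: "z = (t, y)" and t: "t \<in> {0..1}" and y: "y \<in> S2" by blast
          then have "0 \<le> 2 * y v" "2 * y v \<le> 1" using sv[of y] by (auto simp: S2_def)
          then have "2 * y v * t \<in> {0..1}" using t by (auto intro: mult_le_one)
          then show "(2 * snd z v * fst z, q (snd z)) \<in> {0..1} \<times> RQ"
            using qQ[OF y] z by simp
        qed
      qed
      then have Hx: "continuous_on ({0..1} \<times> S2) (\<lambda>z. H (2 * snd z v * fst z, q (snd z)) x)" for x
        by (rule continuous_on_product_then_coordinatewise)
      have "continuous_on ({0..1} \<times> S2) (\<lambda>z x. (if x = v then 2 * snd z v else 0)
          + (1 - 2 * snd z v) * H (2 * snd z v * fst z, q (snd z)) x)"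
        by (intro continuous_on_coordinatewise_then_product continuous_on_if_const continuous_intros Hx)
      then show ?thesis
        by (rule continuous_on_eq) (auto simp: K2)
    qed
    moreover have "closedin (top_of_set ({0..1::real} \<times> R)) ({0..1} \<times> S)" if "closedin (top_of_set R) S" for S
      using that by (intro closedin_Times) auto
    note this[OF closed(1)] this[OF closed(2)] this[OF closed(3)]
    moreover have "{0..1::real} \<times> R = {0..1} \<times> S1 \<union> {0..1} \<times> S2 \<union> {0..1} \<times> S3"
      using R_S by auto
    ultimately show ?thesis
      by (intro continuous_on_closed_Un3[of "{0..1} \<times> R"])
  qed
  have K0_hom: "homotopic_with_canon (\<lambda>_. True) R R id (\<lambda>y. K (0, y))"
    unfolding R_def
  proof (rule contiguous_homotopic; fold R_def)
    show "continuous_on R (\<lambda>y. K (0, y))"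
      by (rule continuous_on_compose2[OF Kc]) (auto intro: continuous_intros)
    show "is_chain le (supp (id y) \<union> supp (K (0, y)))" if "y \<in> R" for y
    proof -
      have "supp (K (0, y)) \<subseteq> supp y"
      proof -
        have "supp (K (0, y)) \<subseteq> supp y" if "y \<in> S1" using K1 that by auto
        moreover have "supp (K (0, y)) \<subseteq> supp y" if "y \<in> S3" using K3[OF that] that
          by (auto simp: S3_def supp_def)
        moreover have "supp (K (0, y)) \<subseteq> supp y" if "y \<in> S2"
        proof
          fix x assume "x \<in> supp (K (0, y))"
          then have "(if x = v then 2 * y v else 0) + (1 - 2 * y v) * q y x \<noteq> 0"
            by (simp add: supp_def K2[OF that] H0)
          moreover have "q y v = 0" using supp_q[OF that] by (auto simp: supp_def)
          ultimately have "x = v \<and> y v \<noteq> 0 \<or> x \<in> supp (q y)" by (auto simp: supp_def split: if_splits)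
          then show "x \<in> supp y" unfolding supp_q[OF that] by (auto simp: supp_def)
        qed
        ultimately show ?thesis using R_S \<open>y \<in> R\<close> by blast
      qed
      then show ?thesis using that by (auto simp: R_def realization_def intro: is_chain_subset)
    qed
  qed (use KR in \<open>auto intro: continuous_on_id\<close>)
  have K01: "homotopic_with_canon (\<lambda>_. True) R R (\<lambda>y. K (0, y)) (\<lambda>y. K (1, y))"
    by (rule homotopic_with_canonI[OF Kc]) (use KR in auto)
  have K1_hom: "homotopic_with_canon (\<lambda>_. True) R R (\<lambda>y. K (1, y)) r"
    unfolding R_def
  proof (rule contiguous_homotopic; fold R_def)
    show "continuous_on R (\<lambda>y. K (1, y))"
      by (rule continuous_on_compose2[OF Kc]) (auto intro: continuous_intros)
    show "is_chain le (supp (K (1, y)) \<union> supp (r y))" if "y \<in> R" for y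
    proof -
      have ?thesis if "y \<in> S1" using that K1 r1 by (auto simp: S1_def R_def realization_def)
      moreover have ?thesis if "y \<in> S3"
      proof (rule is_chain_subset[OF vQ[OF p]])
        show "supp (K (1, y)) \<union> supp (r y) \<subseteq> insert v (supp p)"
          unfolding K3[OF that] r3[OF that] by (auto simp: supp_def)
      qed
      moreover have ?thesis if y: "y \<in> S2"
      proof (rule is_chain_subset[OF vQ])
        show "H (2 * y v, q y) \<in> RQ"
          using y sv[of y] by (intro HQ qQ) (auto simp: S2_def)
        show "supp (K (1, y)) \<union> supp (r y) \<subseteq> insert v (supp (H (2 * y v, q y)))"
          unfolding K2[OF y] r2[OF y] by (auto simp: supp_def)
      qed
      ultimately show ?thesis using R_S that by blast
    qed
  qed (use KR rc rRP QR in auto)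
  have hom_r: "homotopic_with_canon (\<lambda>_. True) R R (id \<circ> r) id"
    using homotopic_with_trans[OF homotopic_with_trans[OF K0_hom K01] K1_hom]
    by (simp add: homotopic_with_sym)
  show ?thesis
    unfolding R_def[symmetric] RP_def[symmetric]
  proof (rule homotopy_equivalent_top_of_setI[OF rc _ _ _ hom_r])
    show "homotopic_with_canon (\<lambda>_. True) RP RP (r \<circ> id) id"
      using r_id by (intro homotopic_with_canon_cong) (auto intro: continuous_on_subset[OF rc] simp: QR)
  qed (use rRP QR in \<open>auto intro: continuous_on_id\<close>)
qed

section \<open>The intervals for r = 2\<close>

text \<open>Since \<open>2c = pa + qb\<close>, every element of the monoid is uniquely \<open>ia + jb + ec\<close> with
  \<open>e \<in> {0, 1}\<close>.\<close>

fun nf :: "nat \<Rightarrow> nat \<Rightarrow> nat \<times> nat \<times> nat \<Rightarrow> nat \<times> nat \<times> nat" where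
  "nf p q (m, n, k) = (m + p * (k div 2), n + q * (k div 2), k mod 2)"

text \<open>Subtracting c from an element without c requires exchanging pa + qb for 2c first; this
  is the extra \<open>p\<close> and \<open>q\<close> when \<open>e' < e\<close>.\<close>

fun nle :: "nat \<Rightarrow> nat \<Rightarrow> nat \<times> nat \<times> nat \<Rightarrow> nat \<times> nat \<times> nat \<Rightarrow> bool" where
  "nle p q (i, j, e) (i', j', e') \<longleftrightarrow>
     (if e' < e then i + p \<le> i' \<and> j + q \<le> j' else i \<le> i' \<and> j \<le> j')"

definition intv :: "nat \<Rightarrow> nat \<Rightarrow> nat \<times> nat \<times> nat \<Rightarrow> (nat \<times> nat \<times> nat) set" where
  "intv p q w = {(i, j, e). e \<le> 1 \<and> (i, j, e) \<noteq> (0, 0, 0) \<and> (i, j, e) \<noteq> w \<and> nle p q (i, j, e) w}"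

lemma nf_id: "e \<le> 1 \<Longrightarrow> nf p q (i, j, e) = (i, j, e)"
  by simp

lemma pres_step_nf: "pres_step p q 2 u v \<Longrightarrow> nf p q u = nf p q v"
  by (auto simp: pres_step_def)

lemma pres_cong_sym: "pres_cong p q r u v \<Longrightarrow> pres_cong p q r v u"
  unfolding pres_cong_def by (rule sympD[OF symp_rtranclp[OF symp_on_symclp]])

lemma pres_cong_nf: "pres_cong p q 2 (m, n, k) (nf p q (m, n, k))"
proof (induction k arbitrary: m n rule: less_induct)
  case (less k)
  show ?case
  proof (cases "k < 2")
    case True
    then show ?thesis by (simp add: pres_cong_def)
  next
    case False
    then obtain k' where k: "k = k' + 2" by (metis add.commute le_Suc_ex not_less)
    have "pres_step p q 2 (m + p, n + q, k') (m, n, k)" unfolding k pres_step_def by blast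
    then have "symclp (pres_step p q 2) (m, n, k) (m + p, n + q, k')" by (simp add: symclp_def)
    moreover have "pres_cong p q 2 (m + p, n + q, k') (nf p q (m + p, n + q, k'))"
      using less k by simp
    moreover have "nf p q (m + p, n + q, k') = nf p q (m, n, k)" by (simp add: k)
    ultimately show ?thesis unfolding pres_cong_def by (metis converse_rtranclp_into_rtranclp)
  qed
qed

text \<open>\<open>nf\<close> is invariant under the generating steps and congruent to its argument,
  so it selects exactly one representative of each class.\<close>

lemma pres_cong_iff_nf: "pres_cong p q 2 u v \<longleftrightarrow> nf p q u = nf p q v"
proof
  assume "pres_cong p q 2 u v"
  then show "nf p q u = nf p q v"
    unfolding pres_cong_def
    by (induction rule: rtranclp_induct) (auto simp: symclp_def dest: pres_step_nf)
next
  assume eq: "nf p q u = nf p q v"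
  have "pres_cong p q 2 u (nf p q u)" "pres_cong p q 2 (nf p q v) v"
    by (metis pres_cong_nf prod_cases3) (metis pres_cong_nf pres_cong_sym prod_cases3)
  then show "pres_cong p q 2 u v"
    unfolding eq pres_cong_def by auto
qed

lemma cls_eq_iff: "cls p q 2 u = cls p q 2 v \<longleftrightarrow> nf p q u = nf p q v"
  unfolding cls_def pres_cong_iff_nf set_eq_iff mem_Collect_eq by metis

lemma nle_nf_add: "nle p q (nf p q (x, y, z)) (nf p q (x + x', y + y', z + z'))"
proof (cases "(z + z') mod 2 < z mod 2")
  case True
  \<comment> \<open>A drop of the parity from 1 to 0 forces a carry, and the carry supplies the
    extra \<open>p\<close> and \<open>q\<close>.\<close>
  then have "z div 2 + 1 \<le> (z + z') div 2" by presburger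
  then show ?thesis
    using True mult_le_mono2[of "z div 2 + 1" "(z + z') div 2" p]
      mult_le_mono2[of "z div 2 + 1" "(z + z') div 2" q] by simp
next
  case False
  have "z div 2 \<le> (z + z') div 2" by presburger
  then show ?thesis
    using False mult_le_mono2[of "z div 2" "(z + z') div 2" p]
      mult_le_mono2[of "z div 2" "(z + z') div 2" q] by (simp add: trans_le_add2)
qed

lemma lam_le_cls_iff: "lam_le p q 2 (cls p q 2 u) (cls p q 2 v) \<longleftrightarrow> nle p q (nf p q u) (nf p q v)"
proof
  assume "lam_le p q 2 (cls p q 2 u) (cls p q 2 v)"
  then show "nle p q (nf p q u) (nf p q v)"
    unfolding lam_le_def cls_eq_iff using nle_nf_add by metis
next
  obtain i j e where u: "nf p q u = (i, j, e)" by (metis prod_cases3)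
  obtain i' j' e' where v: "nf p q v = (i', j', e')" by (metis prod_cases3)
  have e: "e \<le> 1" "e' \<le> 1" using u v by (cases u, cases v, auto)+
  assume "nle p q (nf p q u) (nf p q v)"
  then have le: "nle p q (i, j, e) (i', j', e')" using u v by simp
  have "\<exists>x' y' z'. nf p q (i + x', j + y', e + z') = (i', j', e')"
  proof (cases "e' < e")
    case True
    then have "e = 1" "e' = 0" using e by auto
    \<comment> \<open>The difference contains one more c. Together with the c already present it
      carries over to pa + qb, which was subtracted from the other two coordinates in
      advance.\<close>
    then have "nf p q (i + (i' - i - p), j + (j' - j - q), e + 1) = (i', j', e')"
      using le by simp
    then show ?thesis by blast
  next
    case False
    then have "nf p q (i + (i' - i), j + (j' - j), e + (e' - e)) = (i', j', e')"
      using le e by simp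
    then show ?thesis by blast
  qed
  then show "lam_le p q 2 (cls p q 2 u) (cls p q 2 v)"
    unfolding lam_le_def cls_eq_iff u v by (metis e(1) nf_id)
qed

lemma finite_intv: "finite (intv p q w)"
proof -
  obtain I J E where "w = (I, J, E)" by (metis prod_cases3)
  then have "intv p q w \<subseteq> {..I} \<times> {..J} \<times> {..1}"
    by (auto simp: intv_def split: if_splits)
  then show ?thesis by (rule finite_subset) auto
qed

lemma frobenius_complex_homotopy_equivalent:
  "frobenius_complex p q 2 (cls p q 2 u) homotopy_equivalent_space
    top_of_set (realization (intv p q (nf p q u)) (nle p q))"
proof -
  let ?D = "intv p q (nf p q u)"
  have nfD: "nf p q d = d" if "d \<in> ?D" for d using that by (auto simp: intv_def)
  have img: "cls p q 2 ` ?D = open_interval_Lam p q 2 (cls p q 2 u)"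
  proof (intro equalityI subsetI)
    fix A assume "A \<in> cls p q 2 ` ?D"
    then obtain d where d: "A = cls p q 2 d" "d \<in> ?D" by blast
    then show "A \<in> open_interval_Lam p q 2 (cls p q 2 u)"
      using nfD[OF d(2)] by (auto simp: open_interval_Lam_def Lam_def lam_lt_def lam_le_cls_iff cls_eq_iff intv_def)
  next
    fix A assume A: "A \<in> open_interval_Lam p q 2 (cls p q 2 u)"
    then obtain w where w: "A = cls p q 2 w" by (auto simp: open_interval_Lam_def Lam_def)
    obtain i j e where nfw: "nf p q w = (i, j, e)" by (metis prod_cases3)
    then have "e \<le> 1" by (cases w) auto
    then have "A = cls p q 2 (i, j, e)" using w nfw by (simp add: cls_eq_iff nf_id)
    moreover have "(i, j, e) \<in> ?D"
      using A nfw \<open>e \<le> 1\<close> unfolding w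
      by (auto simp: open_interval_Lam_def lam_lt_def lam_le_cls_iff cls_eq_iff intv_def)
    ultimately show "A \<in> cls p q 2 ` ?D" by blast
  qed
  have "inj_on (cls p q 2) ?D" by (rule inj_onI) (metis nfD cls_eq_iff)
  then have bij: "bij_betw (cls p q 2) ?D (open_interval_Lam p q 2 (cls p q 2 u))"
    using img by (simp add: bij_betw_def)
  have "realization ?D (nle p q) homotopy_eqv
      realization (open_interval_Lam p q 2 (cls p q 2 u)) (lam_le p q 2)"
    by (rule realization_iso[OF finite_intv bij]) (simp add: lam_le_cls_iff nfD)
  moreover have "finite (open_interval_Lam p q 2 (cls p q 2 u))"
    using img finite_intv by (metis finite_imageI)
  ultimately show ?thesis
    unfolding frobenius_complex_def
    by (metis order_complex_real_eq_realization homotopy_equivalent_space_sym)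
qed

section \<open>Joins with copies of the 0-sphere\<close>

text \<open>Level \<open>i\<close> lies above level \<open>j\<close> when \<open>i < j\<close>, so that a new level is inserted directly above
  the base.\<close>

fun tower_le :: "('a \<Rightarrow> 'a \<Rightarrow> bool) \<Rightarrow> 'a + nat \<times> bool \<Rightarrow> 'a + nat \<times> bool \<Rightarrow> bool" where
  "tower_le le (Inl x) (Inl y) = le x y"
| "tower_le le (Inl x) (Inr t) = True"
| "tower_le le (Inr s) (Inl y) = False"
| "tower_le le (Inr s) (Inr t) = (fst t < fst s \<or> s = t)"

text \<open>Its realization plays the role of the \<open>l\<close>-fold suspension of that of
  \<open>A\<close>.\<close>

definition tower :: "'a set \<Rightarrow> nat \<Rightarrow> ('a + nat \<times> bool) set" where
  "tower A l = Inl ` A \<union> Inr ` ({..<l} \<times> UNIV)"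

lemma finite_tower: "finite A \<Longrightarrow> finite (tower A l)"
  by (auto simp: tower_def)

lemma realization_cong:
  assumes "\<And>x y. x \<in> P \<Longrightarrow> y \<in> P \<Longrightarrow> le x y \<longleftrightarrow> le' x y"
  shows "realization P le = realization P le'"
proof -
  have "is_chain le A \<longleftrightarrow> is_chain le' A" if "A \<subseteq> P" for A
    using assms that unfolding is_chain_def by blast
  then show ?thesis unfolding realization_def by blast
qed

lemma realization_nonempty: "finite P \<Longrightarrow> p \<in> P \<Longrightarrow> le p p \<Longrightarrow> realization P le \<noteq> {}"
  using vertex_in_realization[of P p le] by blast

section \<open>The order on normal forms and the suspension step\<close>

lemma nle_refl: "nle p q d d"
  by (cases d) simp

lemma nle_trans: "nle p q x y \<Longrightarrow> nle p q y z \<Longrightarrow> nle p q x z"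
  by (cases x; cases y; cases z) (auto split: if_splits)

text \<open>If the last entries differed, one of the two comparisons would shift the first
  coordinate by \<open>p\<close>, contradicting the other.\<close>

lemma nle_antisym: "1 \<le> p \<Longrightarrow> nle p q x y \<Longrightarrow> nle p q y x \<Longrightarrow> x = y"
  by (cases x; cases y) (auto split: if_splits)

lemma mem_intv:
  "d \<in> intv p q w \<longleftrightarrow> snd (snd d) \<le> 1 \<and> d \<noteq> (0, 0, 0) \<and> d \<noteq> w \<and> nle p q d w"
  by (cases d) (simp add: intv_def)

text \<open>Here \<mu> is the normal form of \<lambda> - c. Whatever makes the base contractible
  leaves the added levels fixed, as these are comparable with every base element. The order
  \<open>lem\<close> is a parameter because the suspension step works with an order that differs
  from \<open>tower_le\<close> at one further point.\<close>

lemma contractible_tower_minus: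
  assumes p: "1 \<le> p" "1 \<le> q" and E: "E \<le> 1"
    and \<mu>: "\<mu> = (if E = 1 then (I, J, 0) else (I - p, J - q, 1))"
    and le: "E = 0 \<Longrightarrow> p \<le> I \<and> q \<le> J" and "\<mu> \<noteq> (0, 0, 0)" "(I, J, E) \<noteq> (1, 1, 0)"
    and lem: "\<And>x y. x \<in> tower (intv p q (I, J, E)) l \<Longrightarrow> y \<in> tower (intv p q (I, J, E)) l \<Longrightarrow>
      lem x y \<longleftrightarrow> tower_le (nle p q) x y"
  shows "contractible (realization (tower (intv p q (I, J, E)) l - {Inl \<mu>}) lem) \<and>
    tower (intv p q (I, J, E)) l - {Inl \<mu>} \<noteq> {}"
proof -
  define D where "D = intv p q (I, J, E) - {\<mu>}"
  define Q where "Q = tower D l"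
  let ?tle = "tower_le (nle p q)"
  have Qeq: "tower (intv p q (I, J, E)) l - {Inl \<mu>} = Q"
    unfolding Q_def D_def tower_def by auto
  have fin: "finite Q" unfolding Q_def D_def by (simp add: finite_tower finite_intv)
  have Req: "realization Q lem = realization Q ?tle"
    by (rule realization_cong, rule lem) (auto simp flip: Qeq)
  have D: "(i, j, e) \<in> D \<longleftrightarrow> e \<le> 1 \<and> (i, j, e) \<noteq> (0, 0, 0) \<and> (i, j, e) \<noteq> (I, J, E)
      \<and> nle p q (i, j, e) (I, J, E) \<and> (i, j, e) \<noteq> \<mu>" for i j e
    by (auto simp: D_def intv_def)
  \<comment> \<open>The elements \<lambda> - a, \<lambda> - b and \<lambda> - a - b. When
    \<open>I = 0\<close> or \<open>J = 0\<close>, truncated subtraction spoils some of them, and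
    only the remaining one is used.\<close>
  define \<alpha> where "\<alpha> = (I - 1, J, E)"
  define \<beta> where "\<beta> = (I, J - 1, E)"
  define \<gamma> where "\<gamma> = (I - 1, J - 1, E)"
  have cone: "contractible (realization Q ?tle) \<and> Q \<noteq> {}" if "c \<in> D" "\<And>d. d \<in> D \<Longrightarrow> nle p q c d \<or> nle p q d c" for c
  proof -
    have "contractible (realization Q ?tle)"
    proof (rule contractible_realization_cone[OF fin])
      show "Inl c \<in> Q" using that by (simp add: Q_def tower_def)
      show "?tle (Inl c) y \<or> ?tle y (Inl c)" if "y \<in> Q" for y
      proof (cases y)
        case (Inl d)
        then show ?thesis
          using that \<open>\<And>d. d \<in> D \<Longrightarrow> nle p q c d \<or> nle p q d c\<close>[of d] by (auto simp: Q_def tower_def)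
      qed simp
    qed
    then show ?thesis using that by (auto simp: Q_def tower_def)
  qed
  consider "I = 0" | "J = 0" | "1 \<le> I" "1 \<le> J" by linarith
  then have "contractible (realization Q ?tle) \<and> Q \<noteq> {}"
  proof cases
    case 1
    \<comment> \<open>With \<open>I = 0\<close> the case \<open>E = 0\<close> is impossible, so
      \<lambda> is Jb + c. Once \<mu>, which is Jb, is removed, \<beta> is the greatest element of
      the base.\<close>
    have "\<beta> \<in> D" unfolding \<beta>_def D using assms 1 by (auto split: if_splits)
    moreover have "nle p q d \<beta>" if "d \<in> D" for d
      using that assms 1 unfolding \<beta>_def by (cases d) (auto simp: D split: if_splits)
    ultimately show ?thesis using cone by metis
  next
    case 2
    have "\<alpha> \<in> D" unfolding \<alpha>_def D using assms 2 by (auto split: if_splits)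
    moreover have "nle p q d \<alpha>" if "d \<in> D" for d
      using that assms 2 unfolding \<alpha>_def by (cases d) (auto simp: D split: if_splits)
    ultimately show ?thesis using cone by metis
  next
    case 3
    \<comment> \<open>\<gamma> is nonzero because \<lambda> is not a + b, and all three differ from
      \<mu> in the last entry.\<close>
    have mem: "\<alpha> \<in> D" "\<beta> \<in> D" "\<gamma> \<in> D"
      unfolding \<alpha>_def \<beta>_def \<gamma>_def D using assms 3 by (auto split: if_splits)
    have ab: "nle p q d \<alpha> \<or> nle p q d \<beta>" if "d \<in> D" for d
      using that assms 3 unfolding \<alpha>_def \<beta>_def by (cases d) (auto simp: D split: if_splits)
    have c: "nle p q d \<gamma>" if "nle p q d \<alpha>" "nle p q d \<beta>" for d
      using that 3 unfolding \<alpha>_def \<beta>_def \<gamma>_def by (cases d) (auto split: if_splits)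
    have rel: "nle p q \<alpha> \<alpha>" "nle p q \<beta> \<beta>" "nle p q \<gamma> \<alpha>" "nle p q \<gamma> \<beta>" "nle p q \<gamma> \<gamma>"
      "\<not> nle p q \<alpha> \<beta>" "\<not> nle p q \<beta> \<alpha>"
      unfolding \<alpha>_def \<beta>_def \<gamma>_def using 3 by auto
    \<comment> \<open>An element below only one of \<alpha> and \<beta> is moved up to that one.
      What remains of the base is \<alpha>, \<beta> and the elements below both, all of them
      comparable with \<gamma>.\<close>
    define e where "e x = (case x of Inl d \<Rightarrow> if \<not> nle p q d \<beta> then Inl \<alpha>
        else if \<not> nle p q d \<alpha> then Inl \<beta> else Inl d | Inr t \<Rightarrow> Inr t)" for x :: "(nat \<times> nat \<times> nat) + nat \<times> bool"
    define N where "N = tower ({d \<in> D. nle p q d \<alpha> \<and> nle p q d \<beta>} \<union> {\<alpha>, \<beta>}) l"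
    have NQ: "N \<subseteq> Q" unfolding N_def Q_def tower_def using mem by auto
    have "realization Q ?tle homotopy_eqv realization N ?tle"
    proof (rule realization_retract[OF fin NQ])
      show "e x \<in> N" if "x \<in> Q" for x
        using that by (auto simp: e_def N_def Q_def tower_def)
      show "e x = x" if "x \<in> N" for x
        using that rel by (auto simp: e_def N_def tower_def)
      fix x y assume xy: "x \<in> Q" "y \<in> Q" "?tle x y"
      show "(?tle (e x) y \<or> ?tle y (e x)) \<and> (?tle x (e y) \<or> ?tle (e y) x) \<and>
          (?tle (e x) (e y) \<or> ?tle (e y) (e x))"
      proof (cases x)
        case (Inr t)
        then show ?thesis using xy by (cases y) (auto simp: e_def)
      next
        case x: (Inl d)
        show ?thesis
        proof (cases y)
          case (Inr t)
          then show ?thesis using x by (auto simp: e_def)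
        next
          case y: (Inl d')
          have d: "d \<in> D" "d' \<in> D" "nle p q d d'" using xy x y by (auto simp: Q_def tower_def)
          show ?thesis
            using d ab[OF d(1)] ab[OF d(2)] rel unfolding x y e_def
            by (simp; meson nle_trans)
        qed
      qed
    qed
    moreover have "contractible (realization N ?tle)"
    proof (rule contractible_realization_cone)
      show "finite N" using NQ fin finite_subset by blast
      show "Inl \<gamma> \<in> N" unfolding N_def tower_def using mem rel by auto
      show "?tle (Inl \<gamma>) y \<or> ?tle y (Inl \<gamma>)" if "y \<in> N" for y
        using that rel c by (auto simp: N_def tower_def)
    qed
    moreover have "Q \<noteq> {}" using mem by (auto simp: Q_def tower_def)
    ultimately show ?thesis
      using homotopy_equivalent_space_contractibility contractible_space_top_of_set by blast
  qed
  then show ?thesis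
    unfolding Qeq Req .
qed

text \<open>A point \<open>v\<close> is inserted directly above the base, but made incomparable with
  \<mu>. Its link is the tower without \<mu>, which is contractible, so inserting \<open>v\<close>
  does not change the homotopy type. Afterwards every base element not below \<mu> can be moved up
  to \<open>v\<close>. What is left is the interval below \<mu> with the antichain of \<mu> and
  \<open>v\<close> directly above it, that is, a tower with one more level.\<close>

lemma tower_suspension:
  assumes p: "1 \<le> p" "1 \<le> q" and E: "E \<le> 1"
    and \<mu>: "\<mu> = (if E = 1 then (I, J, 0) else (I - p, J - q, 1))"
    and le: "E = 0 \<Longrightarrow> p \<le> I \<and> q \<le> J" and \<mu>0: "\<mu> \<noteq> (0, 0, 0)" and ne: "(I, J, E) \<noteq> (1, 1, 0)"
  shows "realization (tower (intv p q (I, J, E)) l) (tower_le (nle p q)) homotopy_eqv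
    realization (tower (intv p q \<mu>) (Suc l)) (tower_le (nle p q))"
proof -
  let ?tle = "tower_le (nle p q)"
  let ?P = "tower (intv p q (I, J, E)) l"
  define v :: "(nat \<times> nat \<times> nat) + nat \<times> bool" where "v = Inr (l, False)"
  define M where "M = insert v ?P"
  define lem where "lem x y \<longleftrightarrow> ?tle x y \<and> \<not> (x = Inl \<mu> \<and> y = v)" for x y
  have finP: "finite ?P" by (simp add: finite_tower finite_intv)
  then have fin: "finite M" by (simp add: M_def)
  have vP: "v \<notin> ?P" by (auto simp: v_def tower_def)
  have lemP: "lem x y \<longleftrightarrow> ?tle x y" if "x \<in> ?P" "y \<in> ?P" for x y
    using that vP by (auto simp: lem_def)
  have \<mu>D: "\<mu> \<in> intv p q (I, J, E)"
    using assms by (auto simp: intv_def split: if_splits)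
  have \<mu>le: "nle p q \<mu> \<mu>" by (rule nle_refl)
  have \<mu>max: "\<not> nle p q \<mu> d" "nle p q d \<mu>" if "d \<in> intv p q \<mu>" for d
    using that nle_antisym[OF p(1), of q d \<mu>] by (auto simp: mem_intv simp del: nle.simps)
  have sub: "intv p q \<mu> \<subseteq> intv p q (I, J, E)" "\<mu> \<notin> intv p q \<mu>"
  proof
    fix d assume d: "d \<in> intv p q \<mu>"
    have "nle p q \<mu> (I, J, E)" using \<mu>D by (simp add: mem_intv del: nle.simps)
    then show "d \<in> intv p q (I, J, E)"
      using d \<mu>max[OF d] nle_trans[of p q d \<mu> "(I, J, E)"] by (auto simp: mem_intv simp del: nle.simps)
  qed (simp add: mem_intv)
  have below: "d \<in> intv p q \<mu>" if "d \<in> intv p q (I, J, E)" "nle p q d d'" "d' = \<mu> \<or> d' \<in> intv p q \<mu>" "d \<noteq> \<mu>" for d d'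
    using that nle_trans[of p q d d' \<mu>] by (auto simp: mem_intv simp del: nle.simps)
  \<comment> \<open>Nothing lies strictly between \<mu> and \<lambda>. Otherwise the retraction
    \<open>e\<close> would send an element above \<mu> to \<open>v\<close>, which is incomparable
    with \<mu>.\<close>
  have coatom: "d = \<mu>" if "d \<in> intv p q (I, J, E)" "nle p q \<mu> d" for d
    using that \<mu> E le by (cases d) (auto simp: intv_def le_Suc_eq split: if_splits)
  have rP: "realization ?P lem = realization ?P ?tle"
    by (rule realization_cong) (rule lemP)
  have Q: "?P - {Inl \<mu>} = {y \<in> M. y \<noteq> v \<and> (lem y v \<or> lem v y)}"
    using vP by (auto simp: M_def lem_def v_def tower_def)
  have "M - {v} = ?P" using vP by (auto simp: M_def)
  moreover have "realization M lem homotopy_eqv realization (M - {v}) lem"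
  proof (rule realization_delete[OF fin _ _ Q])
    show "contractible (realization (?P - {Inl \<mu>}) lem)"
      using contractible_tower_minus[OF assms lemP] by blast
    obtain x where x: "x \<in> ?P - {Inl \<mu>}"
      using contractible_tower_minus[OF assms lemP] by blast
    have "lem x x" using x lemP by (cases x) auto
    then show "realization (?P - {Inl \<mu>}) lem \<noteq> {}"
      using x finP by (intro realization_nonempty) auto
  qed (auto simp: M_def lem_def v_def)
  ultimately have 1: "realization M lem homotopy_eqv realization ?P ?tle"
    using rP by simp
  define N where "N = insert v (tower (insert \<mu> (intv p q \<mu>)) l)"
  define e where "e x = (case x of Inl d \<Rightarrow> if d = \<mu> \<or> d \<in> intv p q \<mu> then x else v | Inr t \<Rightarrow> x)" for x
  have 2: "realization M lem homotopy_eqv realization N lem"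
  proof (rule realization_retract[OF fin])
    show "N \<subseteq> M" using sub \<mu>D by (auto simp: N_def M_def tower_def)
    show "e x \<in> N" if "x \<in> M" for x
      using that by (auto simp: e_def N_def M_def tower_def v_def)
    show "e x = x" if "x \<in> N" for x
      using that by (auto simp: e_def N_def tower_def v_def)
    fix x y assume xy: "x \<in> M" "y \<in> M" "lem x y"
    show "(lem (e x) y \<or> lem y (e x)) \<and> (lem x (e y) \<or> lem (e y) x) \<and> (lem (e x) (e y) \<or> lem (e y) (e x))"
    proof (cases x)
      case x: (Inr t)
      then show ?thesis using xy by (cases y) (auto simp: e_def lem_def v_def)
    next
      case x: (Inl d)
      have d: "d \<in> intv p q (I, J, E)" using xy x by (auto simp: M_def v_def tower_def)
      show ?thesis
      proof (cases y)
        case y: (Inr t)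
        then have "t = (l, False) \<or> fst t < l" using xy by (auto simp: M_def v_def tower_def)
        then show ?thesis using xy x y by (auto simp: e_def lem_def v_def)
      next
        case y: (Inl d')
        have le: "nle p q d d'" using xy x y by (simp add: lem_def)
        have "d' = \<mu> \<or> d' \<in> intv p q \<mu> \<Longrightarrow> d = \<mu> \<or> d \<in> intv p q \<mu>"
          using below[OF d le] by blast
        moreover have "d \<noteq> \<mu>" if "d' \<in> intv p q \<mu>" using \<mu>max that le by blast
        moreover have "d' \<in> intv p q (I, J, E)" using xy y by (auto simp: M_def v_def tower_def)
        ultimately show ?thesis using x y le below[OF d le] \<mu>le coatom[of d']
          by (auto simp: e_def lem_def v_def)
      qed
    qed
  qed
  define \<phi> where "\<phi> x = (if x = Inl \<mu> then Inr (l, True) else x)" for x :: "(nat \<times> nat \<times> nat) + nat \<times> bool"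
  have 3: "realization N lem homotopy_eqv realization (tower (intv p q \<mu>) (Suc l)) ?tle"
  proof (rule realization_iso)
    show "finite N" by (simp add: N_def finite_tower finite_intv)
    show "bij_betw \<phi> N (tower (intv p q \<mu>) (Suc l))"
    proof (rule bij_betw_imageI)
      show "inj_on \<phi> N" by (auto simp: inj_on_def \<phi>_def N_def tower_def v_def)
      show "\<phi> ` N = tower (intv p q \<mu>) (Suc l)"
      proof (intro equalityI subsetI)
        show "x \<in> tower (intv p q \<mu>) (Suc l)" if "x \<in> \<phi> ` N" for x
          using that sub by (auto simp: \<phi>_def N_def tower_def v_def)
        fix x assume x: "x \<in> tower (intv p q \<mu>) (Suc l)"
        have "x = Inr (l, True) \<or> (x \<in> N \<and> x \<noteq> Inl \<mu>)"
          using x sub by (auto simp: N_def tower_def v_def less_Suc_eq)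
        then consider "x = Inr (l, True)" | "x \<in> N" "x \<noteq> Inl \<mu>" by blast
        then show "x \<in> \<phi> ` N"
        proof cases
          case 1
          then have "x = \<phi> (Inl \<mu>)" "Inl \<mu> \<in> N" by (auto simp: \<phi>_def N_def tower_def)
          then show ?thesis by blast
        next
          case 2
          then have "x = \<phi> x" by (simp add: \<phi>_def)
          then show ?thesis using 2 by blast
        qed
      qed
    qed
    fix x y assume "x \<in> N" "y \<in> N"
    then show "lem x y \<longleftrightarrow> ?tle (\<phi> x) (\<phi> y)"
      using \<mu>max \<mu>le sub by (auto simp: \<phi>_def N_def tower_def v_def lem_def)
  qed
  show ?thesis
    using 1 2 3 by (meson homotopy_equivalent_space_sym homotopy_eqv_trans)
qed

section \<open>Spheres\<close>

text \<open>A chain contains at most one of the two points of level \<open>i\<close>, so their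
  weights amount to one real coordinate. \<open>unsigned\<close> recovers the weights as positive
  and negative part.\<close>

definition signed :: "('a + nat \<times> bool \<Rightarrow> real) \<Rightarrow> nat \<Rightarrow> real" where
  "signed f i = f (Inr (i, True)) - f (Inr (i, False))"

definition unsigned :: "real \<Rightarrow> bool \<Rightarrow> real" where
  "unsigned x b = (if b then max x 0 else max (- x) 0)"

lemma continuous_on_signed [continuous_intros]: "continuous_on S (\<lambda>f. signed f i)"
  unfolding signed_def by (intro continuous_intros)

lemma continuous_on_unsigned [continuous_intros]:
  "continuous_on S f \<Longrightarrow> continuous_on S (\<lambda>x. unsigned (f x) b)"
  unfolding unsigned_def by (intro continuous_on_if_const continuous_intros)

lemma unsigned_nonneg [simp]: "0 \<le> unsigned x b"
  by (simp add: unsigned_def)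

lemma unsigned_diff: "unsigned x True - unsigned x False = x"
  by (simp add: unsigned_def)

lemma realization_tower_Inr:
  assumes "f \<in> realization (tower A l) (tower_le le)"
  shows "f (Inr (i, True)) = 0 \<or> f (Inr (i, False)) = 0"
proof (rule ccontr)
  assume "\<not> ?thesis"
  then have "Inr (i, True) \<in> supp f" "Inr (i, False) \<in> supp f" by (auto simp: supp_def)
  then have "tower_le le (Inr (i, True)) (Inr (i, False)) \<or> tower_le le (Inr (i, False)) (Inr (i, True))"
    using assms unfolding realization_def is_chain_def by blast
  then show False by simp
qed

lemma signed_eq_0_iff:
  assumes "f \<in> realization (tower A l) (tower_le le)"
  shows "signed f i = 0 \<longleftrightarrow> f (Inr (i, True)) = 0 \<and> f (Inr (i, False)) = 0"
  using realization_tower_Inr[OF assms, of i] by (auto simp: signed_def)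

text \<open>Rescaling a signed coordinate by a nonnegative factor creates no new vertex. This
  controls the supports of the composite maps in both comparisons with Euclidean models.\<close>

lemma unsigned_signed_supp:
  assumes "f \<in> realization (tower A l) (tower_le le)" "unsigned (c * signed f i) b \<noteq> 0" "0 \<le> c"
  shows "Inr (i, b) \<in> supp f"
proof -
  have nn: "0 \<le> f (Inr (i, True))" "0 \<le> f (Inr (i, False))"
    using assms(1) by (auto simp: realization_def)
  consider "b" "0 < c * signed f i" | "\<not> b" "c * signed f i < 0"
    using assms(2) by (auto simp: unsigned_def max_def split: if_splits)
  then show ?thesis
    using nn assms(3)
    by cases (auto simp: supp_def signed_def zero_less_mult_iff mult_less_0_iff)
qed

lemma realization_nonzero:
  assumes "f \<in> realization P le"
  obtains x where "x \<in> P" "f x \<noteq> 0"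
proof -
  have "sum f P \<noteq> 0" using assms by (simp add: realization_def)
  then show ?thesis using that by (metis sum.neutral)
qed

text \<open>The complex is the boundary of the cross-polytope with coordinates
  \<open>signed f i\<close> for \<open>i \<le> d\<close>. \<open>F\<close> is the radial projection
  onto the Euclidean unit sphere, and \<open>G\<close> projects back by dividing by the sum of the
  absolute values.\<close>

lemma realization_tower_sphere:
  "top_of_set (realization (tower {} (Suc d)) (tower_le le)) homotopy_equivalent_space nsphere d"
proof -
  let ?P = "tower {} (Suc d) :: ('a + nat \<times> bool) set"
  let ?R = "realization ?P (tower_le le)"
  define S where "S = {x :: nat \<Rightarrow> real. (\<Sum>i\<le>d. (x i)\<^sup>2) = 1 \<and> (\<forall>i>d. x i = 0)}"
  have S: "nsphere d = top_of_set S"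
    unfolding nsphere S_def by (simp add: euclidean_product_topology)
  have fin: "finite ?P" by (simp add: finite_tower)
  define F where "F f i = (if i \<le> d then signed f i / sqrt (\<Sum>j\<le>d. (signed f j)\<^sup>2) else 0)"
    for f :: "'a + nat \<times> bool \<Rightarrow> real" and i
  define g where "g y x = (case x of Inl _ \<Rightarrow> 0 | Inr (i, b) \<Rightarrow> unsigned (y i) b)"
    for y :: "nat \<Rightarrow> real" and x :: "'a + nat \<times> bool"
  have pos: "0 < (\<Sum>j\<le>d. (signed f j)\<^sup>2)" if f: "f \<in> ?R" for f
  proof -
    obtain x where x: "x \<in> ?P" "f x \<noteq> 0" using realization_nonzero[OF f] .
    then obtain i b where "x = Inr (i, b)" "i \<le> d" by (auto simp: tower_def)
    then have "signed f i \<noteq> 0" using signed_eq_0_iff[OF f, of i] x by (cases b) auto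
    then show ?thesis using \<open>i \<le> d\<close> by (intro sum_pos2[of _ i]) auto
  qed
  have FS: "F f \<in> S" if "f \<in> ?R" for f
    using pos[OF that] by (simp add: S_def F_def power_divide sum_divide_distrib[symmetric] sum_nonneg)
  have Fc: "continuous_on ?R F"
    unfolding F_def
    by (intro continuous_on_coordinatewise_then_product continuous_on_if_const continuous_intros)
      (use pos in force)
  have gnn: "0 \<le> g y x" for y x by (auto simp: g_def split: sum.split)
  have gD: thesis if "x \<in> supp (g y)" "\<And>i b. x = Inr (i, b) \<Longrightarrow> unsigned (y i) b \<noteq> 0 \<Longrightarrow> thesis"
    for x y thesis
    using that by (cases x) (auto simp: supp_def g_def)
  have gsupp: "supp (g y) \<subseteq> ?P" if "y \<in> S" for y
  proof
    fix x assume "x \<in> supp (g y)"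
    then obtain i b where x: "x = Inr (i, b)" "unsigned (y i) b \<noteq> 0" by (rule gD)
    then have "\<not> d < i" using that by (auto simp: S_def unsigned_def split: if_splits)
    then show "x \<in> ?P" using x by (auto simp: tower_def)
  qed
  have gchain: "is_chain (tower_le le) (supp (g y))" for y
    unfolding is_chain_def
  proof (intro ballI)
    fix x x' assume "x \<in> supp (g y)" "x' \<in> supp (g y)"
    then obtain i b i' b' where "x = Inr (i, b)" "unsigned (y i) b \<noteq> 0"
      "x' = Inr (i', b')" "unsigned (y i') b' \<noteq> 0" by (metis gD)
    then show "tower_le le x x' \<or> tower_le le x' x"
      by (cases i i' rule: linorder_cases) (auto simp: unsigned_def split: if_splits)
  qed
  have gsum: "0 < sum (g y) ?P" if y: "y \<in> S" for y
  proof -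
    obtain i where i: "i \<le> d" "y i \<noteq> 0"
      using y unfolding S_def by (metis (mono_tags, lifting) atMost_iff mem_Collect_eq power_zero_numeral sum.neutral zero_neq_one)
    have "g y (Inr (i, 0 < y i)) \<noteq> 0" using i by (auto simp: g_def unsigned_def)
    then show ?thesis
      using i by (intro sum_pos_of_supp[OF fin gnn, of "Inr (i, 0 < y i)"]) (auto simp: tower_def)
  qed
  define G where "G y = normalize_on ?P (g y)" for y
  have GR: "G y \<in> ?R" if "y \<in> S" for y
    unfolding G_def using gsum[OF that] gsupp[OF that] gchain gnn
    by (intro normalize_on_in_realization) auto
  have Gc: "continuous_on S G"
    unfolding G_def
  proof (rule continuous_on_normalize_on)
    show "continuous_on S (\<lambda>y. g y x)" for x
      unfolding g_def by (cases x) (auto intro!: continuous_intros split: prod.split)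
  qed (use gsum in force)
  have FG: "F (G y) = y" if y: "y \<in> S" for y
  proof
    fix i
    define c where "c = sum (g y) ?P"
    have c: "c > 0" using gsum[OF y] by (simp add: c_def)
    have sg: "signed (G y) j = y j / c" for j
    proof -
      have "G y x = g y x / c" for x by (simp add: G_def normalize_on_def c_def)
      then show ?thesis
        by (simp add: signed_def g_def unsigned_diff diff_divide_distrib[symmetric])
    qed
    have "(\<Sum>j\<le>d. (signed (G y) j)\<^sup>2) = 1 / c\<^sup>2"
      using y by (simp add: sg power_divide sum_divide_distrib[symmetric] S_def)
    then have "sqrt (\<Sum>j\<le>d. (signed (G y) j)\<^sup>2) = 1 / c"
      using c by (simp add: real_sqrt_divide)
    then show "F (G y) i = y i" using c y by (simp add: F_def sg S_def)
  qed
  have "?R homotopy_eqv S"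
  proof (rule homotopy_equivalent_top_of_setI[OF Fc _ Gc])
    show "homotopic_with_canon (\<lambda>_. True) S S (F \<circ> G) id"
      using FG by (intro homotopic_with_canon_cong continuous_on_compose Gc continuous_on_subset[OF Fc])
        (use GR in auto)
    show "homotopic_with_canon (\<lambda>_. True) ?R ?R (G \<circ> F) id"
    proof (rule contiguous_homotopic)
      show "continuous_on ?R (G \<circ> F)"
        using FS by (intro continuous_on_compose Fc continuous_on_subset[OF Gc]) auto
      show "is_chain (tower_le le) (supp ((G \<circ> F) f) \<union> supp (id f))" if f: "f \<in> ?R" for f
      proof -
        have "supp (G (F f)) = supp (g (F f))"
          unfolding G_def using gsum[OF FS[OF f]] by (intro supp_normalize_on) simp
        also have "\<dots> \<subseteq> supp f"
        proof
          fix x assume x: "x \<in> supp (g (F f))"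
          then obtain i b where ib: "x = Inr (i, b)" "unsigned (F f i) b \<noteq> 0"
            by (rule gD)
          then have "F f i = 1 / sqrt (\<Sum>j\<le>d. (signed f j)\<^sup>2) * signed f i"
            by (auto simp: F_def unsigned_def split: if_splits)
          then have "unsigned (1 / sqrt (\<Sum>j\<le>d. (signed f j)\<^sup>2) * signed f i) b \<noteq> 0"
            using ib by simp
          moreover have "0 \<le> 1 / sqrt (\<Sum>j\<le>d. (signed f j)\<^sup>2)" by (simp add: sum_nonneg)
          ultimately show "x \<in> supp f"
            unfolding ib by (rule unsigned_signed_supp[OF f])
        qed
        finally show ?thesis using f by (simp add: realization_def Un_absorb1)
      qed
    qed (use FS GR in \<open>auto intro: continuous_on_id\<close>)
  qed (use FS GR in auto)
  then show ?thesis unfolding S .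
qed

section \<open>The wedge of two spheres\<close>

text \<open>Both spheres in one equation: expanding the squares, the unit spheres around
  \<open>e_0\<close> and \<open>-e_0\<close> consist of the points whose squared norm is
  \<open>2 * x 0\<close> and \<open>- 2 * x 0\<close> respectively. A squared norm is nonnegative,
  so it decides the sign.\<close>

definition wedge_set :: "nat \<Rightarrow> (nat \<Rightarrow> real) set" where
  "wedge_set d = {x. (\<forall>i>d. x i = 0) \<and> (\<Sum>i\<le>d. (x i)\<^sup>2) = 2 * \<bar>x 0\<bar>}"

lemma sum_atMost_split0: "(\<Sum>i\<le>d. f i) = f 0 + (\<Sum>i\<in>{1..d}. f i)" for f :: "nat \<Rightarrow> real"
proof -
  have "{..d} = insert 0 {1..d}" by auto
  then show ?thesis by simp
qed

lemma wedge_two_spheres_eq: "wedge_two_spheres d = top_of_set (wedge_set d)"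
proof -
  have "(x 0 - 1)\<^sup>2 + s = 1 \<or> (x 0 + 1)\<^sup>2 + s = 1 \<longleftrightarrow> (x 0)\<^sup>2 + s = 2 * \<bar>x 0\<bar>"
    if "0 \<le> s" for x :: "nat \<Rightarrow> real" and s
  proof -
    have "0 \<le> (x 0)\<^sup>2 + s" using that by simp
    then show ?thesis by (auto simp: power2_eq_square algebra_simps abs_if)
  qed
  note * = this[OF sum_nonneg]
  have "wedge_set d = {x. (\<forall>i>d. x i = 0) \<and>
         ((x 0 - 1)\<^sup>2 + (\<Sum>i\<in>{1..d}. (x i)\<^sup>2) = 1 \<or> (x 0 + 1)\<^sup>2 + (\<Sum>i\<in>{1..d}. (x i)\<^sup>2) = 1)}"
    unfolding wedge_set_def sum_atMost_split0 by (subst *) auto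
  then show ?thesis
    unfolding wedge_two_spheres_def by (simp add: euclidean_product_topology)
qed

lemma zero_in_wedge_set: "(\<lambda>_. 0) \<in> wedge_set d"
  by (simp add: wedge_set_def)

text \<open>The ray through \<open>v\<close> meets the unit sphere around \<open>\<plusminus>e\<^sub>0\<close> again in
  \<open>2\<bar>v\<^sub>0\<bar> v / \<bar>v\<bar>\<^sup>2\<close>.\<close>

lemma project_in_wedge_set:
  assumes "\<And>i. d < i \<Longrightarrow> v i = 0" and n: "v 0 \<noteq> 0 \<Longrightarrow> n = (\<Sum>i\<le>d. (v i)\<^sup>2)"
  shows "(\<lambda>i. 2 * \<bar>v 0\<bar> * v i / n) \<in> wedge_set d"
proof (cases "v 0 = 0")
  case True
  then show ?thesis by (simp add: zero_in_wedge_set)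
next
  case False
  have "0 < (\<Sum>i\<le>d. (v i)\<^sup>2)" using False by (intro sum_pos2[of _ 0]) auto
  then have n0: "0 < n" using n False by simp
  have "(\<Sum>i\<le>d. (2 * \<bar>v 0\<bar> * v i / n)\<^sup>2) = (2 * \<bar>v 0\<bar> / n)\<^sup>2 * (\<Sum>i\<le>d. (v i)\<^sup>2)"
    by (simp add: sum_distrib_left power_mult_distrib power_divide)
  also have "\<dots> = (2 * \<bar>v 0\<bar> / n)\<^sup>2 * n" using n[OF False] by simp
  also have "\<dots> = 2 * \<bar>2 * \<bar>v 0\<bar> * v 0 / n\<bar>"
    using n0 by (simp add: power2_eq_square abs_mult)
  finally show ?thesis using assms(1) by (simp add: wedge_set_def)
qed

text \<open>Soft thresholding: \<open>x\<close> is shrunk towards 0 by \<open>t\<close> and stops at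
  0. At \<open>t = 1\<close> it is the difference of the weights that the map from the wedge to the
  tower will give to the points \<open>a\<close> and \<open>b\<close>.\<close>

definition soft :: "real \<Rightarrow> real \<Rightarrow> real" where
  "soft x t = max (x - t) 0 - max (- x - t) 0"

lemma abs_soft: "0 \<le> t \<Longrightarrow> \<bar>soft x t\<bar> = max (\<bar>x\<bar> - t) 0"
  by (auto simp: soft_def max_def abs_if)

text \<open>At time \<open>t\<close> of the homotopy the caps \<open>\<bar>x\<^sub>0\<bar> \<le> t\<close> have been collapsed to the base point.\<close>

lemma wedge_set_homotopy:
  "homotopic_with_canon (\<lambda>_. True) (wedge_set d) (wedge_set d) id
     (\<lambda>x i. 2 * \<bar>soft (x 0) 1\<bar> * (if i = 0 then soft (x 0) 1 else x i))"
proof -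
  let ?W = "wedge_set d"
  define V where "V t x i = (if i = 0 then soft (x 0) t else x i)" for t and x :: "nat \<Rightarrow> real" and i :: nat
  \<comment> \<open>On the wedge this is the squared norm of \<open>V t x\<close> as long as
    \<open>\<bar>x 0\<bar> > t\<close>. Elsewhere \<open>V t x 0\<close> is 0 and so is
    \<open>G\<close>, and the polynomial just continues the denominator.\<close>
  define D where "D t x = t\<^sup>2 + 2 * \<bar>x 0\<bar> * (1 - t)" for t and x :: "nat \<Rightarrow> real"
  define G where "G = (\<lambda>(t, x) i. 2 * \<bar>V t x 0\<bar> * V t x i / D t x)"
  have W: "(x 0)\<^sup>2 + (\<Sum>i\<in>{1..d}. (x i)\<^sup>2) = 2 * \<bar>x 0\<bar>" if "x \<in> ?W" for x
    using that by (simp add: wedge_set_def sum_atMost_split0)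
  have x0: "\<bar>x 0\<bar> \<le> 2" if "x \<in> ?W" for x
  proof -
    have "0 \<le> (\<Sum>i\<in>{1..d}. (x i)\<^sup>2)" by (simp add: sum_nonneg)
    then have "(x 0)\<^sup>2 \<le> 2 * \<bar>x 0\<bar>" using W[OF that] by linarith
    then have "\<bar>x 0\<bar> * \<bar>x 0\<bar> \<le> 2 * \<bar>x 0\<bar>" by (simp add: power2_eq_square)
    then show ?thesis by (metis abs_ge_zero less_eq_real_def mult_le_cancel_right not_less zero_le_numeral)
  qed
  have D0: "0 \<le> D t x" if "t \<in> {0..1}" for t x using that by (auto simp: D_def)
  have Dzero: "x i = 0" if "t \<in> {0..1}" "x \<in> ?W" "D t x = 0" for t x i
  proof -
    have "t\<^sup>2 = 0" "2 * \<bar>x 0\<bar> * (1 - t) = 0"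
      using that by (auto simp: D_def add_nonneg_eq_0_iff)
    then have "x 0 = 0" by auto
    then have "(\<Sum>i\<le>d. (x i)\<^sup>2) = 0" using that by (simp add: wedge_set_def)
    then have "\<And>i. i \<le> d \<Longrightarrow> x i = 0" by (simp add: sum_nonneg_eq_0_iff)
    then show ?thesis using that by (cases "i \<le> d") (auto simp: wedge_set_def)
  qed
  have wD: "\<bar>soft (x 0) t\<bar> \<le> D t x" if t: "t \<in> {0..1}" and x: "x \<in> ?W" for t x
  proof -
    have "\<bar>x 0\<bar> - t \<le> D t x"
    \<comment> \<open>The difference of the two sides is affine in \<open>\<bar>x 0\<bar>\<close>
      with slope \<open>1 - 2 * t\<close>, and \<open>\<bar>x 0\<bar>\<close> ranges over [0, 2].
      The two cases expand it around the end where it is smallest, 0 or 2.\<close>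
    proof (cases "t \<le> 1/2")
      case True
      then have "0 \<le> \<bar>x 0\<bar> * (1 - 2 * t)" by simp
      moreover have "D t x - (\<bar>x 0\<bar> - t) = t\<^sup>2 + t + \<bar>x 0\<bar> * (1 - 2 * t)"
        by (simp add: D_def algebra_simps)
      moreover have "0 \<le> t\<^sup>2 + t" using t by simp
      ultimately show ?thesis by linarith
    next
      case False
      have "0 \<le> (2 - \<bar>x 0\<bar>) * (2 * t - 1) + (1 - t) * (2 - t)"
        using False t x0[OF x] by auto
      moreover have "D t x - (\<bar>x 0\<bar> - t) = (2 - \<bar>x 0\<bar>) * (2 * t - 1) + (1 - t) * (2 - t)"
        by (simp add: D_def algebra_simps power2_eq_square)
      ultimately show ?thesis by linarith
    qed
    then show ?thesis using D0[OF t, of x] t by (auto simp: abs_soft)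
  qed
  \<comment> \<open>The denominator vanishes at time 0 at the touching point of the spheres;
    continuity of \<open>G\<close> there comes from this bound.\<close>
  have bound: "\<bar>G (t, x) i\<bar> \<le> 2 * \<bar>x i\<bar>" if t: "t \<in> {0..1}" and x: "x \<in> ?W" for t x i
  proof -
    have "\<bar>soft (x 0) t\<bar> / D t x \<le> 1"
      using wD[OF t x] D0[OF t, of x] by (auto simp: divide_le_eq_1)
    moreover have "\<bar>V t x i\<bar> \<le> \<bar>x i\<bar>" using t by (auto simp: V_def abs_soft)
    ultimately have "(\<bar>soft (x 0) t\<bar> / D t x) * \<bar>V t x i\<bar> \<le> 1 * \<bar>x i\<bar>"
      by (intro mult_mono) auto
    moreover have "\<bar>G (t, x) i\<bar> = 2 * ((\<bar>soft (x 0) t\<bar> / D t x) * \<bar>V t x i\<bar>)"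
      using D0[OF t, of x] by (simp add: G_def V_def abs_mult)
    ultimately show ?thesis by simp
  qed
  have Vc: "continuous_on S (\<lambda>z. V (fst z) (snd z) i)" for S i
    unfolding V_def soft_def by (intro continuous_on_if_const continuous_intros)
  have Dc: "continuous_on S (\<lambda>z. D (fst z) (snd z))" for S
    unfolding D_def by (intro continuous_intros)
  have "continuous_on ({0..1} \<times> ?W) (\<lambda>z. G z i)" for i
    unfolding continuous_on
  proof
    fix z assume z: "z \<in> {0..1::real} \<times> ?W"
    let ?F = "at z within {0..1} \<times> ?W"
    show "((\<lambda>z. G z i) \<longlongrightarrow> G z i) ?F"
    proof (cases "D (fst z) (snd z) = 0")
      case False
      have "((\<lambda>z. 2 * \<bar>V (fst z) (snd z) 0\<bar> * V (fst z) (snd z) i / D (fst z) (snd z))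
          \<longlongrightarrow> 2 * \<bar>V (fst z) (snd z) 0\<bar> * V (fst z) (snd z) i / D (fst z) (snd z)) ?F"
        using Vc[unfolded continuous_on, rule_format, OF z] Dc[unfolded continuous_on, rule_format, OF z] False
        by (intro tendsto_intros) auto
      then show ?thesis by (simp add: G_def case_prod_unfold)
    next
      case True
      then have zi: "snd z i = 0" using Dzero z by (metis mem_Times_iff)
      have "((\<lambda>z. snd z i) \<longlongrightarrow> 0) ?F"
        using continuous_on_coordinate_snd[unfolded continuous_on, rule_format, OF z, of i] zi by simp
      then have "((\<lambda>z. 2 * \<bar>snd z i\<bar>) \<longlongrightarrow> 0) ?F"
        by (auto intro!: tendsto_eq_intros)
      moreover have "eventually (\<lambda>z. norm (G z i) \<le> 2 * \<bar>snd z i\<bar>) ?F"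
        unfolding eventually_at_filter by (rule always_eventually) (use bound in auto)
      ultimately have "((\<lambda>z. G z i) \<longlongrightarrow> 0) ?F" by (rule Lim_null_comparison[rotated])
      moreover have "G z i = 0" using True by (simp add: G_def case_prod_unfold)
      ultimately show ?thesis by simp
    qed
  qed
  then have "continuous_on ({0..1} \<times> ?W) G"
    by (rule continuous_on_coordinatewise_then_product)
  moreover have "G (t, x) \<in> ?W" if t: "t \<in> {0..1}" and x: "x \<in> ?W" for t x
  proof -
    have "(\<lambda>i. 2 * \<bar>V t x 0\<bar> * V t x i / D t x) \<in> ?W"
    proof (rule project_in_wedge_set)
      show "V t x i = 0" if "d < i" for i using that x by (auto simp: V_def wedge_set_def)
      assume "V t x 0 \<noteq> 0"
      then have "\<bar>V t x 0\<bar> = \<bar>x 0\<bar> - t" using t abs_soft[of t "x 0"] by (auto simp: V_def max_def split: if_splits)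
      then have "(V t x 0)\<^sup>2 = (\<bar>x 0\<bar> - t)\<^sup>2" by (metis power2_abs)
      also have "\<dots> = (x 0)\<^sup>2 - 2 * \<bar>x 0\<bar> * t + t\<^sup>2" by (simp add: power2_diff)
      finally have "(V t x 0)\<^sup>2 + (\<Sum>i\<in>{1..d}. (x i)\<^sup>2) = D t x"
        using W[OF x] by (simp add: D_def algebra_simps)
      then show "D t x = (\<Sum>i\<le>d. (V t x i)\<^sup>2)"
        by (simp add: sum_atMost_split0 V_def)
    qed
    then show ?thesis by (simp add: G_def)
  qed
  moreover have "G (0, x) = id x" if x: "x \<in> ?W" for x
  proof
    fix i
    have "V 0 x = x" by (auto simp: V_def soft_def fun_eq_iff)
    moreover have "x i = 0" if "x 0 = 0" using Dzero[of 0 x i] x that by (simp add: D_def)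
    ultimately show "G (0, x) i = id x i" by (auto simp: G_def D_def)
  qed
  moreover have "G (1, x) = (\<lambda>i. 2 * \<bar>soft (x 0) 1\<bar> * (if i = 0 then soft (x 0) 1 else x i))" for x
    by (auto simp: G_def D_def V_def)
  ultimately show ?thesis
    by (intro homotopic_with_canonI[of ?W G]) auto
qed

lemma realization_tower_Inl:
  assumes "f \<in> realization (tower A l) (tower_le le)" "x \<noteq> y" "\<not> le x y" "\<not> le y x"
  shows "f (Inl x) = 0 \<or> f (Inl y) = 0"
proof (rule ccontr)
  assume "\<not> ?thesis"
  then have "Inl x \<in> supp f" "Inl y \<in> supp f" by (auto simp: supp_def)
  then have "tower_le le (Inl x) (Inl y) \<or> tower_le le (Inl y) (Inl x)"
    using assms(1) unfolding realization_def is_chain_def by blast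
  then show False using assms by simp
qed

text \<open>The join of three points with a sphere is a sphere together with an equatorial disc, and
  collapsing that disc (the join with the third point \<open>c\<close>) leaves two spheres touching in a point.\<close>

lemma realization_tower_wedge:
  assumes dist: "a \<noteq> b" "a \<noteq> c" "b \<noteq> c"
    and le: "\<And>x y. x \<in> {a, b, c} \<Longrightarrow> y \<in> {a, b, c} \<Longrightarrow> le x y \<longleftrightarrow> x = y"
  shows "top_of_set (realization (tower {a, b, c} d) (tower_le le)) homotopy_equivalent_space
    wedge_two_spheres d"
proof -
  let ?P = "tower {a, b, c} d"
  let ?R = "realization ?P (tower_le le)"
  let ?W = "wedge_set d"
  have fin: "finite ?P" by (simp add: finite_tower)
  define v where "v f i = (if i = 0 then f (Inl a) - f (Inl b) else if i \<le> d then signed f (i - 1) else 0)"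
    for f :: "'a + nat \<times> bool \<Rightarrow> real" and i
  \<comment> \<open>The last summand keeps \<open>n\<close> positive at the vertex \<open>c\<close>,
    where \<open>v f\<close> is 0. It does not disturb the projection, because a point with
    \<open>v f 0 \<noteq> 0\<close> has weight 0 on \<open>c\<close>.\<close>
  define n where "n f = (\<Sum>i\<le>d. (v f i)\<^sup>2) + (f (Inl c))\<^sup>2" for f
  \<comment> \<open>The two halves \<open>v f 0 > 0\<close> and \<open>v f 0 < 0\<close> of the
    sphere go to the two spheres of the wedge, and the disc with centre \<open>c\<close>, where
    \<open>v f 0 = 0\<close>, goes to the touching point.\<close>
  define F where "F f i = 2 * \<bar>v f 0\<bar> * v f i / n f" for f i
  \<comment> \<open>The outer hemisphere \<open>x 0 > 1\<close> goes to the half with apex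
    \<open>a\<close>, the outer hemisphere \<open>x 0 < -1\<close> to the half with apex
    \<open>b\<close>, and both inner hemispheres go to the disc with centre \<open>c\<close>. Thus
    each sphere of the wedge covers one half together with the disc. Coordinate 0 belongs to the
    three points, so level \<open>i\<close> carries coordinate \<open>Suc i\<close>.\<close>
  define g where "g x u = (case u of Inl w \<Rightarrow> if w = a then max (x 0 - 1) 0 else if w = b then max (- x 0 - 1) 0
      else if w = c then max (1 - \<bar>x 0\<bar>) 0 else 0
    | Inr (i, s) \<Rightarrow> if i < d then unsigned (x (Suc i)) s else 0)" for x :: "nat \<Rightarrow> real" and u
  define G where "G x = normalize_on ?P (g x)" for x
  have nn: "0 \<le> f u" if "f \<in> ?R" for f u using that by (simp add: realization_def)
  have excl: "f (Inl a) = 0 \<or> f (Inl b) = 0" "f (Inl a) = 0 \<or> f (Inl c) = 0" "f (Inl b) = 0 \<or> f (Inl c) = 0"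
    if f: "f \<in> ?R" for f
    using dist le by (intro realization_tower_Inl[OF f]; auto)+
  have g_simps: "g x (Inl a) = max (x 0 - 1) 0" "g x (Inl b) = max (- x 0 - 1) 0"
    "g x (Inl c) = max (1 - \<bar>x 0\<bar>) 0" "g x (Inr (i, s)) = (if i < d then unsigned (x (Suc i)) s else 0)" for x i s
    using dist by (auto simp: g_def)
  have vc: "continuous_on S (\<lambda>f. v f i)" for S i
    unfolding v_def by (intro continuous_on_if_const continuous_intros)
  have v0: "f (Inl a) = 0 \<and> f (Inl b) = 0" if f: "f \<in> ?R" "v f 0 = 0" for f
    using excl(1)[OF f(1)] f(2) by (auto simp: v_def)
  have vSuc: "f (Inr (i, s)) = 0" if f: "f \<in> ?R" "v f (Suc i) = 0" "i < d" for f i s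
    using signed_eq_0_iff[OF f(1), of i] f by (cases s) (auto simp: v_def)
  have npos: "0 < n f" if f: "f \<in> ?R" for f
  proof (rule ccontr)
    assume "\<not> 0 < n f"
    moreover have "0 \<le> (\<Sum>i\<le>d. (v f i)\<^sup>2)" by (simp add: sum_nonneg)
    ultimately have s: "(\<Sum>i\<le>d. (v f i)\<^sup>2) = 0" and c: "f (Inl c) = 0"
      unfolding n_def by (smt (verit) zero_le_power2 zero_eq_power2)+
    then have v: "v f i = 0" if "i \<le> d" for i using that by (simp add: sum_nonneg_eq_0_iff)
    obtain u where "u \<in> ?P" "f u \<noteq> 0" using realization_nonzero[OF f] .
    then show False using v0[OF f v] c vSuc[OF f v] by (auto simp: tower_def)
  qed
  have FW: "F f \<in> ?W" if f: "f \<in> ?R" for f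
  proof -
    have "(\<lambda>i. 2 * \<bar>v f 0\<bar> * v f i / n f) \<in> ?W"
    proof (rule project_in_wedge_set)
      show "v f i = 0" if "d < i" for i using that by (simp add: v_def)
      assume "v f 0 \<noteq> 0"
      then have "f (Inl c) = 0" using excl[OF f] by (auto simp: v_def)
      then show "n f = (\<Sum>i\<le>d. (v f i)\<^sup>2)" by (simp add: n_def)
    qed
    then show ?thesis by (simp add: F_def[abs_def])
  qed
  have nc: "continuous_on S n" for S
    unfolding n_def by (intro continuous_intros vc)
  have Fc: "continuous_on ?R F"
    unfolding F_def
    by (intro continuous_on_coordinatewise_then_product continuous_intros vc nc) (use npos in force)
  have gnn: "0 \<le> g x u" for x u by (auto simp: g_def split: sum.split)
  have gsupp: "supp (g x) \<subseteq> ?P" for x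
  proof
    show "u \<in> ?P" if "u \<in> supp (g x)" for u
      using that by (cases u) (auto simp: supp_def g_def tower_def split: if_splits)
  qed
  have gchain: "is_chain (tower_le le) (supp (g x))" for x
    unfolding is_chain_def
  proof (intro ballI)
    fix u w assume u: "u \<in> supp (g x)" and w: "w \<in> supp (g x)"
    show "tower_le le u w \<or> tower_le le w u"
    proof (cases u)
      case u': (Inl y)
      show ?thesis
      proof (cases w)
        case (Inl z)
        have "y \<in> {a, b, c}" "z \<in> {a, b, c}" using u w u' Inl gsupp[of x] by (auto simp: tower_def)
        moreover have "y = z"
          using u w u' Inl calculation by (auto simp: supp_def g_simps max_def split: if_splits)
        ultimately show ?thesis using u' Inl le by simp
      qed (use u' in auto)
    next
      case u': (Inr s)
      show ?thesis
      proof (cases w)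
        case (Inr t)
        then show ?thesis
          using u w u' by (cases s; cases t; cases "fst s" "fst t" rule: linorder_cases)
            (auto simp: supp_def g_simps unsigned_def split: if_splits)
      qed (use u' in auto)
    qed
  qed
  have W: "(x 0)\<^sup>2 + (\<Sum>i\<in>{1..d}. (x i)\<^sup>2) = 2 * \<bar>x 0\<bar>" if "x \<in> ?W" for x
    using that by (simp add: wedge_set_def sum_atMost_split0)
  have gsum: "0 < sum (g x) ?P" if x: "x \<in> ?W" for x
  proof (rule ccontr)
    assume neg: "\<not> 0 < sum (g x) ?P"
    have z: "g x u = 0" if "u \<in> ?P" for u
      using sum_pos_of_supp[of ?P "g x", OF fin gnn that] neg by blast
    have "x i = 0" if i: "i \<in> {1..d}" for i
    proof -
      obtain j where j: "i = Suc j" "j < d" using i by (cases i) auto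
      have "g x (Inr (j, s)) = 0" for s using j by (intro z) (auto simp: tower_def)
      then have "unsigned (x i) s = 0" for s using j by (simp add: g_simps)
      then show ?thesis using unsigned_diff[of "x i"] by simp
    qed
    then have "(x 0)\<^sup>2 = 2 * \<bar>x 0\<bar>" using W[OF x] by simp
    moreover have "g x (Inl a) = 0" "g x (Inl b) = 0" "g x (Inl c) = 0"
      by (auto intro!: z simp: tower_def)
    then have "x 0 = 1 \<or> x 0 = -1" by (auto simp: g_simps max_def abs_if split: if_splits)
    ultimately show False by auto
  qed
  have GR: "G x \<in> ?R" if "x \<in> ?W" for x
    unfolding G_def using gsum[OF that] gsupp gchain gnn
    by (intro normalize_on_in_realization) auto
  have Gc: "continuous_on ?W G"
    unfolding G_def
  proof (rule continuous_on_normalize_on)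
    show "continuous_on ?W (\<lambda>x. g x u)" for u
    proof (cases u)
      case (Inl w)
      then show ?thesis
        unfolding g_def by simp (intro continuous_on_if_const continuous_intros)
    next
      case (Inr t)
      then show ?thesis
        unfolding g_def by (cases t) (simp, intro continuous_on_if_const continuous_intros)
    qed
  qed (use gsum in force)
  \<comment> \<open>Before normalization, \<open>n\<close> takes the value 1 at \<open>g x\<close>
    for every \<open>x\<close> in the wedge, so the composite is exactly the end stage of
    \<open>wedge_set_homotopy\<close>.\<close>
  have FG: "F (G x) = (\<lambda>i. 2 * \<bar>soft (x 0) 1\<bar> * (if i = 0 then soft (x 0) 1 else x i))" if x: "x \<in> ?W" for x
  proof
    fix i
    define s where "s = sum (g x) ?P"
    have s: "s > 0" using gsum[OF x] by (simp add: s_def)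
    have G: "G x u = g x u / s" for u by (simp add: G_def normalize_on_def s_def)
    define w where "w i = (if i = 0 then soft (x 0) 1 else x i)" for i
    have vG: "v (G x) i = w i / s" for i
    proof -
      consider "i = 0" | j where "i = Suc j" "j < d" | "d < i"
        by (metis Suc_le_eq not0_implies_Suc not_le)
      then show ?thesis
      proof cases
        case 1
        then show ?thesis by (simp add: v_def w_def G g_simps soft_def diff_divide_distrib)
      next
        case 2
        then show ?thesis
          by (simp add: v_def w_def signed_def G g_simps unsigned_diff diff_divide_distrib[symmetric])
      next
        case 3
        then show ?thesis using x by (simp add: v_def w_def wedge_set_def)
      qed
    qed
    have "(w 0)\<^sup>2 = (max (\<bar>x 0\<bar> - 1) 0)\<^sup>2"
      using abs_soft[of 1 "x 0"] by (metis power2_abs w_def zero_le_one)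
    then have "(w 0)\<^sup>2 + (max (1 - \<bar>x 0\<bar>) 0)\<^sup>2 = (\<bar>x 0\<bar> - 1)\<^sup>2"
      by (cases "\<bar>x 0\<bar> \<le> 1") (auto simp: power2_commute)
    also have "\<dots> = (x 0)\<^sup>2 - 2 * \<bar>x 0\<bar> + 1" by (simp add: power2_diff)
    finally have "(\<Sum>i\<le>d. (w i)\<^sup>2) + (max (1 - \<bar>x 0\<bar>) 0)\<^sup>2 = 1"
      using W[OF x] by (simp add: sum_atMost_split0 w_def)
    moreover have "n (G x) = ((\<Sum>i\<le>d. (w i)\<^sup>2) + (max (1 - \<bar>x 0\<bar>) 0)\<^sup>2) / s\<^sup>2"
      by (simp add: n_def vG G g_simps power_divide sum_divide_distrib add_divide_distrib)
    ultimately have "n (G x) = 1 / s\<^sup>2" by simp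
    then have "F (G x) i = 2 * \<bar>w 0\<bar> * w i"
      using s by (simp add: F_def vG power2_eq_square)
    then show "F (G x) i = 2 * \<bar>soft (x 0) 1\<bar> * (if i = 0 then soft (x 0) 1 else x i)"
      by (simp add: w_def)
  qed
  \<comment> \<open>\<open>G \<circ> F\<close> is not contiguous to the identity: near the equator
    it uses \<open>c\<close> while \<open>f\<close> may still use \<open>a\<close> or
    \<open>b\<close>. The intermediate map \<open>H\<close> first removes \<open>a\<close> and
    \<open>b\<close> there. The threshold \<open>z f\<close> is the length of the equatorial part of
    \<open>v f\<close>: for weight 0 on \<open>c\<close>, the value \<open>\<bar>F f 0\<bar>\<close>
    is below 1 exactly if \<open>\<bar>v f 0\<bar> < z f\<close>.\<close>
  define z where "z f = sqrt (\<Sum>i\<in>{1..d}. (v f i)\<^sup>2)" for f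
  have z0: "0 \<le> z f" for f by (simp add: z_def sum_nonneg)
  define e where "e f u = (if u = Inl a \<or> u = Inl b then max (f u - z f) 0 else f u)" for f u
  define H where "H f = normalize_on ?P (e f)" for f
  have enn: "0 \<le> e f u" if "f \<in> ?R" for f u using nn[OF that] by (simp add: e_def)
  have esupp: "supp (e f) \<subseteq> supp f" if f: "f \<in> ?R" for f
    using nn[OF f] z0[of f] by (auto simp: supp_def e_def max_def)
  have echain: "is_chain (tower_le le) (supp (e f))" "supp (e f) \<subseteq> ?P" if f: "f \<in> ?R" for f
    using esupp[OF f] f by (auto simp: realization_def intro: is_chain_subset)
  have esum: "0 < sum (e f) ?P" if f: "f \<in> ?R" for f
  proof (rule ccontr)
    assume neg: "\<not> 0 < sum (e f) ?P"
    have ez: "e f u = 0" if "u \<in> ?P" for u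
      using sum_pos_of_supp[of ?P "e f", OF fin enn[OF f] that] neg by blast
    have "f (Inr t) = 0" if "Inr t \<in> ?P" for t using ez[OF that] by (simp add: e_def)
    then have "v f i = 0" if "i \<in> {1..d}" for i
      using that by (auto simp: v_def signed_def tower_def)
    then have "z f = 0" by (simp add: z_def)
    then have "e f = f" using nn[OF f] by (auto simp: e_def fun_eq_iff)
    then show False using neg f by (simp add: realization_def)
  qed
  have HR: "H f \<in> ?R" if "f \<in> ?R" for f
    unfolding H_def using esum[OF that] enn[OF that] echain[OF that]
    by (intro normalize_on_in_realization) auto
  have Hc: "continuous_on ?R H"
    unfolding H_def
  proof (rule continuous_on_normalize_on)
    show "continuous_on ?R (\<lambda>f. e f u)" for u
      unfolding e_def z_def by (intro continuous_on_if_const continuous_intros vc)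
  qed (use esum in force)
  have suppH: "supp (H f) = supp (e f)" if "f \<in> ?R" for f
    unfolding H_def using esum[OF that] by (intro supp_normalize_on) simp
  have suppGF: "supp (G (F f)) = supp (g (F f))" if "f \<in> ?R" for f
    unfolding G_def using gsum[OF FW[OF that]] by (intro supp_normalize_on) simp
  have hom1: "homotopic_with_canon (\<lambda>_. True) ?R ?R H id"
  proof (rule contiguous_homotopic)
    show "is_chain (tower_le le) (supp (H f) \<union> supp (id f))" if f: "f \<in> ?R" for f
      using esupp[OF f] suppH[OF f] f by (simp add: realization_def Un_absorb1)
  qed (use HR Hc in \<open>auto intro: continuous_on_id\<close>)
  have hom2: "homotopic_with_canon (\<lambda>_. True) ?R ?R (G \<circ> F) H"
  proof (rule contiguous_homotopic)
    show "continuous_on ?R (G \<circ> F)"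
      using FW by (intro continuous_on_compose Fc continuous_on_subset[OF Gc]) auto
    fix f assume f: "f \<in> ?R"
    define x where "x = F f"
    have n: "n f = (v f 0)\<^sup>2 + (z f)\<^sup>2 + (f (Inl c))\<^sup>2"
      by (simp add: n_def sum_atMost_split0 z_def sum_nonneg)
    have Inr: "Inr t \<in> supp f" if "Inr t \<in> supp (g x)" for t
    proof -
      obtain i s where t: "t = (i, s)" by (cases t)
      have i: "i < d" and "unsigned (x (Suc i)) s \<noteq> 0"
        using that by (auto simp: supp_def g_simps t split: if_splits)
      moreover have "x (Suc i) = (2 * \<bar>v f 0\<bar> / n f) * signed f i"
        using i by (simp add: x_def F_def v_def)
      ultimately show ?thesis
        unfolding t using npos[OF f] by (intro unsigned_signed_supp[OF f, of "2 * \<bar>v f 0\<bar> / n f"]) auto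
    qed
    have sgn: "0 < v f 0" if "0 < x 0"
      using that npos[OF f] by (simp add: x_def F_def zero_less_divide_iff zero_less_mult_iff)
    have sgn': "v f 0 < 0" if "x 0 < 0"
      using that npos[OF f] by (simp add: x_def F_def divide_less_0_iff mult_less_0_iff)
    have a: "Inl a \<in> supp f" if "Inl a \<in> supp (g x)"
    proof -
      have "1 < x 0" using that by (auto simp: supp_def g_simps)
      then show ?thesis using sgn nn[OF f, of "Inl b"] by (auto simp: v_def supp_def)
    qed
    have b: "Inl b \<in> supp f" if "Inl b \<in> supp (g x)"
    proof -
      have "x 0 < -1" using that by (auto simp: supp_def g_simps)
      then show ?thesis using sgn' nn[OF f, of "Inl a"] by (auto simp: v_def supp_def)
    qed
    have gP: "u = Inl a \<or> u = Inl b \<or> u = Inl c \<or> (\<exists>t. u = Inr t)" if "u \<in> supp (g x)" for u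
      using that gsupp[of x] by (auto simp: tower_def)
    have "is_chain (tower_le le) (supp (g x) \<union> supp (e f))"
    proof (cases "Inl c \<in> supp (g x)")
      case False
      then have "supp (g x) \<union> supp (e f) \<subseteq> supp f" using esupp[OF f] a b Inr gP by blast
      then show ?thesis using f by (auto simp: realization_def intro: is_chain_subset)
    next
      case True
      then have x1: "\<bar>x 0\<bar> < 1" by (auto simp: supp_def g_simps)
      have "\<bar>v f 0\<bar> \<le> z f" if "v f 0 \<noteq> 0"
      proof (rule ccontr)
        assume "\<not> \<bar>v f 0\<bar> \<le> z f"
        then have "(z f)\<^sup>2 < (v f 0)\<^sup>2" using z0[of f] by (metis not_le power2_abs power_strict_mono zero_less_numeral)
        moreover have "f (Inl c) = 0" using that excl[OF f] by (auto simp: v_def)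
        ultimately have "n f < 2 * (v f 0)\<^sup>2" using n by simp
        moreover have "\<bar>x 0\<bar> = 2 * (v f 0)\<^sup>2 / n f"
          using npos[OF f] by (simp add: x_def F_def abs_mult power2_eq_square)
        ultimately show False using x1 npos[OF f] by (simp add: divide_less_eq)
      qed
      then have "\<bar>v f 0\<bar> \<le> z f" using z0[of f] by fastforce
      then have "f (Inl a) \<le> z f" "f (Inl b) \<le> z f"
        using excl(1)[OF f] nn[OF f, of "Inl a"] nn[OF f, of "Inl b"] z0[of f] by (auto simp: v_def)
      then have ab: "Inl a \<notin> supp (e f)" "Inl b \<notin> supp (e f)" by (auto simp: supp_def e_def)
      have ab': "Inl a \<notin> supp (g x)" "Inl b \<notin> supp (g x)" using x1 by (auto simp: supp_def g_simps)
      have sub: "supp (g x) \<union> supp (e f) \<subseteq> insert (Inl c) (Inr ` {t. Inr t \<in> supp f})"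
      proof
        fix u assume u: "u \<in> supp (g x) \<union> supp (e f)"
        have "u \<in> ?P" using u gsupp echain(2)[OF f] by blast
        then consider "u = Inl c" | t where "u = Inr t" using u ab ab' by (auto simp: tower_def)
        then show "u \<in> insert (Inl c) (Inr ` {t. Inr t \<in> supp f})"
          using u Inr esupp[OF f] by cases auto
      qed
      have "is_chain (tower_le le) (insert (Inl c) (Inr ` {t. Inr t \<in> supp f}))"
        unfolding is_chain_def
      proof (intro ballI)
        fix u w assume uw: "u \<in> insert (Inl c) (Inr ` {t. Inr t \<in> supp f})"
          "w \<in> insert (Inl c) (Inr ` {t. Inr t \<in> supp f})"
        have fc: "is_chain (tower_le le) (supp f)" using f by (simp add: realization_def)
        consider "u = Inl c" | "w = Inl c" | "u \<in> supp f" "w \<in> supp f" using uw by blast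
        then show "tower_le le u w \<or> tower_le le w u"
        proof cases
          case 3
          then show ?thesis using fc unfolding is_chain_def by blast
        qed (use uw le[of c c] in auto)
      qed
      then show ?thesis using sub by (rule is_chain_subset)
    qed
    then show "is_chain (tower_le le) (supp ((G \<circ> F) f) \<union> supp (H f))"
      using suppGF[OF f] suppH[OF f] by (simp add: x_def)
  qed (use HR Hc FW GR in auto)
  have "?R homotopy_eqv ?W"
  proof (rule homotopy_equivalent_top_of_setI[OF Fc _ Gc])
    show "homotopic_with_canon (\<lambda>_. True) ?R ?R (G \<circ> F) id"
      using hom2 hom1 by (rule homotopic_with_trans)
    have "homotopic_with_canon (\<lambda>_. True) ?W ?W (F \<circ> G)
        (\<lambda>x i. 2 * \<bar>soft (x 0) 1\<bar> * (if i = 0 then soft (x 0) 1 else x i))"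
    proof (rule homotopic_with_canon_cong)
      show "continuous_on ?W (F \<circ> G)"
        using GR by (intro continuous_on_compose Gc continuous_on_subset[OF Fc]) auto
      show "F \<circ> G \<in> ?W \<rightarrow> ?W" using GR FW by auto
    qed (simp add: FG)
    then show "homotopic_with_canon (\<lambda>_. True) ?W ?W (F \<circ> G) id"
      by (rule homotopic_with_trans[OF _ homotopic_with_symD[OF wedge_set_homotopy]])
  qed (use FW GR in auto)
  then show ?thesis unfolding wedge_two_spheres_eq .
qed

section \<open>Frobenius complexes\<close>

lemma homotopy_equivalent_pt_space:
  assumes "contractible_space X" "topspace X \<noteq> {}"
  shows "X homotopy_equivalent_space pt_space"
proof -
  obtain a where a: "a \<in> topspace X" using assms by blast
  have pt: "contractible_space pt_space" unfolding pt_space_def by simp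
  have c: "continuous_map X pt_space (\<lambda>_. ())" "continuous_map pt_space X (\<lambda>_. a)"
    using a by (auto simp: pt_space_def)
  have "homotopic_with (\<lambda>x. True) X X ((\<lambda>_. a) \<circ> (\<lambda>_. ())) id"
    by (intro homotopic_into_contractible_space conjI continuous_map_compose[OF c] continuous_map_id assms(1))
  moreover have "homotopic_with (\<lambda>x. True) pt_space pt_space ((\<lambda>_. ()) \<circ> (\<lambda>_. a)) id"
    by (intro homotopic_into_contractible_space conjI continuous_map_compose[OF c(2,1)] continuous_map_id pt)
  ultimately show ?thesis
    unfolding homotopy_equivalent_space_def using c by blast
qed

text \<open>The base is a grid of height at most 1 without its least and greatest corner. Moving (m,
  0, 0) to (m - 1, 0, 0), which is nonzero as \<open>2 \<le> m\<close>, leaves only elements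
  comparable with (m - 1, n, 0). For \<open>n = 0\<close> the move is vacuous, since (m, 0, 0) is
  the removed corner.\<close>

lemma tower_contractible_1:
  assumes mn: "2 \<le> m" "n \<le> 1" and pq: "m < p \<or> n < q"
  shows "contractible (realization (tower (intv p q (m, n, 0)) l) (tower_le (nle p q)))"
proof -
  let ?D = "intv p q (m, n, 0)" and ?tle = "tower_le (nle p q)"
  have D: "(i, j, e) \<in> ?D \<longleftrightarrow> e = 0 \<and> (i, j) \<noteq> (0, 0) \<and> (i, j) \<noteq> (m, n) \<and> i \<le> m \<and> j \<le> n" for i j e
    using pq by (auto simp: intv_def)
  define N where "N = tower (?D - {(m, 0, 0)}) l"
  define e where "e x = (if x = Inl (m, 0, 0) then Inl (m - 1, 0, 0) else x)"
    for x :: "(nat \<times> nat \<times> nat) + nat \<times> bool"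
  have fin: "finite (tower ?D l)" by (simp add: finite_tower finite_intv)
  have NT: "N \<subseteq> tower ?D l" by (auto simp: N_def tower_def)
  have "realization (tower ?D l) ?tle homotopy_eqv realization N ?tle"
  proof (rule realization_retract[OF fin NT])
    show "e x \<in> N" if "x \<in> tower ?D l" for x
      using that mn by (auto simp: e_def N_def tower_def D)
    show "e x = x" if "x \<in> N" for x using that by (auto simp: e_def N_def tower_def)
    fix x y assume "x \<in> tower ?D l" "y \<in> tower ?D l" "?tle x y"
    then show "(?tle (e x) y \<or> ?tle y (e x)) \<and> (?tle x (e y) \<or> ?tle (e y) x) \<and>
        (?tle (e x) (e y) \<or> ?tle (e y) (e x))"
      using mn by (auto simp: e_def tower_def D split: if_splits)
  qed
  moreover have "contractible (realization N ?tle)"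
  proof (rule contractible_realization_cone)
    show "finite N" using NT fin finite_subset by blast
    show "Inl (m - 1, n, 0) \<in> N" using mn by (auto simp: N_def tower_def D)
    show "?tle (Inl (m - 1, n, 0)) y \<or> ?tle y (Inl (m - 1, n, 0))" if "y \<in> N" for y
      using that mn by (auto simp: N_def tower_def D)
  qed
  ultimately show ?thesis
    using homotopy_equivalent_space_contractibility contractible_space_top_of_set by blast
qed

lemma tower_swap:
  "realization (tower (intv p q (m, n, e)) l) (tower_le (nle p q)) homotopy_eqv
    realization (tower (intv q p (n, m, e)) l) (tower_le (nle q p))"
proof -
  define s where "s = (\<lambda>(i :: nat, j :: nat, e :: nat). (j, i, e))"
  have s: "s (i, j, e) = (j, i, e)" for i j e by (simp add: s_def)
  have "inj s" by (auto simp: s_def inj_on_def)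
  then have inj: "inj (map_sum s (id :: nat \<times> bool \<Rightarrow> nat \<times> bool))" by (rule sum.inj_map) simp
  have img: "s ` intv p q (m, n, e) = intv q p (n, m, e)"
  proof (intro equalityI subsetI)
    show "x \<in> intv q p (n, m, e)" if "x \<in> s ` intv p q (m, n, e)" for x
      using that by (auto simp: s intv_def)
    fix x assume x: "x \<in> intv q p (n, m, e)"
    then have "x = s (s x)" "s x \<in> intv p q (m, n, e)" by (auto simp: s intv_def)
    then show "x \<in> s ` intv p q (m, n, e)" by blast
  qed
  show ?thesis
  proof (rule realization_iso)
    show "finite (tower (intv p q (m, n, e)) l)" by (simp add: finite_tower finite_intv)
    show "bij_betw (map_sum s id) (tower (intv p q (m, n, e)) l) (tower (intv q p (n, m, e)) l)"
    proof (rule bij_betw_imageI)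
      show "inj_on (map_sum s id) (tower (intv p q (m, n, e)) l)" using inj inj_on_subset by blast
      show "map_sum s id ` tower (intv p q (m, n, e)) l = tower (intv q p (n, m, e)) l"
        by (simp add: tower_def image_Un image_image flip: img)
    qed
    show "tower_le (nle p q) x y \<longleftrightarrow> tower_le (nle q p) (map_sum s id x) (map_sum s id y)" for x y
      by (cases x; cases y) (auto simp: s)
  qed
qed

lemma tower_contractible:
  assumes "2 \<le> m \<and> n \<le> 1 \<or> m \<le> 1 \<and> 2 \<le> n" "m < p \<or> n < q"
  shows "contractible (realization (tower (intv p q (m, n, 0)) l) (tower_le (nle p q)))"
    and "realization (tower (intv p q (m, n, 0)) l) (tower_le (nle p q)) \<noteq> {}"
proof -
  show "contractible (realization (tower (intv p q (m, n, 0)) l) (tower_le (nle p q)))"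
  proof (cases "2 \<le> m")
    case True
    then show ?thesis using assms by (intro tower_contractible_1) auto
  next
    case False
    then have "contractible (realization (tower (intv q p (n, m, 0)) l) (tower_le (nle q p)))"
      using assms by (intro tower_contractible_1) auto
    then show ?thesis
      using tower_swap homotopy_equivalent_space_contractibility contractible_space_top_of_set by blast
  qed
  have "(1, 0, 0) \<in> intv p q (m, n, 0) \<or> (0, 1, 0) \<in> intv p q (m, n, 0)"
    using assms by (auto simp: intv_def)
  then obtain x where "x \<in> intv p q (m, n, 0)" by blast
  then show "realization (tower (intv p q (m, n, 0)) l) (tower_le (nle p q)) \<noteq> {}"
    by (intro realization_nonempty[of _ "Inl x"])
      (auto simp: finite_tower finite_intv nle_refl tower_def simp del: nle.simps)
qed

section \<open>Descending one c at a time\<close>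

lemma nf_eq_a_plus_b:
  assumes "1 \<le> p" "1 \<le> q" "nf p q (m, n, Suc j) = (1, 1, 0)"
  shows "m = 0 \<and> n = 0 \<and> p = 1 \<and> q = 1 \<and> j = 1"
proof -
  define h where "h = Suc j div 2"
  have eq: "m + p * h = 1" "n + q * h = 1" "Suc j mod 2 = 0" using assms by (auto simp: h_def)
  then have "h \<ge> 1" unfolding h_def by presburger
  then have "p \<le> p * h" "q \<le> q * h" "h \<le> p * h" using assms by auto
  then have "p = 1" "q = 1" "h = 1" "m = 0" "n = 0" using eq assms \<open>h \<ge> 1\<close> by linarith+
  moreover have "j = 1" using \<open>h = 1\<close> eq(3) unfolding h_def by presburger
  ultimately show ?thesis by simp
qed

text \<open>The last assumption excludes the step from 2c = a + b to c; by
  \<open>nf_eq_a_plus_b\<close> this is the only step that starts at a + b.\<close>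

lemma tower_step:
  assumes pq: "1 \<le> p" "1 \<le> q" and "(m, n, k) \<noteq> (0, 0, 0)"
    and "\<not> (m = 0 \<and> n = 0 \<and> p = 1 \<and> q = 1 \<and> k = 1)"
  shows "realization (tower (intv p q (nf p q (m, n, Suc k))) l) (tower_le (nle p q)) homotopy_eqv
    realization (tower (intv p q (nf p q (m, n, k))) (Suc l)) (tower_le (nle p q))"
proof -
  define I where "I = m + p * (Suc k div 2)"
  define J where "J = n + q * (Suc k div 2)"
  define E where "E = Suc k mod 2"
  have w: "nf p q (m, n, Suc k) = (I, J, E)" by (simp add: I_def J_def E_def)
  have parity: "E = 1 \<Longrightarrow> Suc k div 2 = k div 2 \<and> k mod 2 = 0"
    "E = 0 \<Longrightarrow> Suc k div 2 = Suc (k div 2) \<and> k mod 2 = 1" "E \<le> 1"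
    unfolding E_def by presburger+
  have \<mu>: "nf p q (m, n, k) = (if E = 1 then (I, J, 0) else (I - p, J - q, 1))"
    using parity by (auto simp: I_def J_def le_Suc_eq)
  have "nf p q (m, n, k) \<noteq> (0, 0, 0)"
  proof
    assume "nf p q (m, n, k) = (0, 0, 0)"
    then have "m = 0" "n = 0" "k div 2 = 0" "k mod 2 = 0" using pq by auto
    then show False using assms by auto
  qed
  moreover have "(I, J, E) \<noteq> (1, 1, 0)"
    using nf_eq_a_plus_b[OF pq, of m n k] assms(4) w by metis
  moreover have "E = 0 \<Longrightarrow> p \<le> I \<and> q \<le> J" using parity by (auto simp: I_def J_def)
  ultimately show ?thesis
    unfolding w by (intro tower_suspension[OF pq parity(3) \<mu>])
qed

text \<open>The descent stops at \<open>k0\<close>: at 0 if \<open>m\<close> or \<open>n\<close> is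
  positive, at 1 for multiples of c in general, and at 2 for multiples of c when p = q = 1. The last
  assumption says that the forbidden step from 2c to c is not crossed. The induction is for an
  arbitrary number \<open>l\<close> of levels, because each step inserts its level below those
  already present.\<close>

lemma frobenius_complex_tower:
  assumes pq: "1 \<le> p" "1 \<le> q" and "(m, n, k0) \<noteq> (0, 0, 0)"
    and "k0 \<le> 1 \<Longrightarrow> \<not> (m = 0 \<and> n = 0 \<and> p = 1 \<and> q = 1 \<and> 1 \<le> k)"
  shows "frobenius_complex p q 2 (cls p q 2 (m, n, k0 + k)) homotopy_equivalent_space
    top_of_set (realization (tower (intv p q (nf p q (m, n, k0))) k) (tower_le (nle p q)))"
proof -
  let ?R = "\<lambda>k l. realization (tower (intv p q (nf p q (m, n, k))) l) (tower_le (nle p q))"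
  have "?R (k0 + k) l homotopy_eqv ?R k0 (k + l)" for l
    using assms(4)
  proof (induction k arbitrary: l)
    case (Suc k)
    have "?R (Suc (k0 + k)) l homotopy_eqv ?R (k0 + k) (Suc l)"
      using assms(3) Suc.prems by (intro tower_step pq) auto
    also have "?R (k0 + k) (Suc l) homotopy_eqv ?R k0 (k + Suc l)"
      by (rule Suc.IH) (use Suc.prems in auto)
    finally show ?case by simp
  qed (simp add: homotopy_equivalent_space_refl)
  from this[of 0] have 1: "?R (k0 + k) 0 homotopy_eqv ?R k0 k" by simp
  have 2: "realization (intv p q (nf p q (m, n, k0 + k))) (nle p q) homotopy_eqv ?R (k0 + k) 0"
    by (rule realization_iso[where \<phi> = Inl]) (auto simp: finite_intv bij_betw_def tower_def)
  show ?thesis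
    using homotopy_eqv_trans[OF homotopy_eqv_trans[OF frobenius_complex_homotopy_equivalent 2] 1] .
qed

section \<open>The bases at which the descent stops\<close>

lemma tower_empty_sphere:
  "top_of_set (realization (tower {} k) (tower_le le)) homotopy_equivalent_space sphere_sp (int k - 1)"
proof (cases k)
  case 0
  then have "realization (tower {} k) (tower_le le) = {}" by (auto simp: realization_def tower_def)
  then show ?thesis using 0 by (auto simp: sphere_sp_def homotopy_equivalent_space_def intro!: homotopic_on_emptyI exI)
next
  case (Suc d)
  then show ?thesis using realization_tower_sphere[of d le] by (simp add: sphere_sp_def)
qed

text \<open>A base of two incomparable points is itself a level: with index \<open>k\<close> it lies
  below the levels 0 to k - 1.\<close>

lemma tower_pair_sphere:
  assumes "a \<noteq> b" "\<And>x y. x \<in> {a, b} \<Longrightarrow> y \<in> {a, b} \<Longrightarrow> le x y \<longleftrightarrow> x = y"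
  shows "top_of_set (realization (tower {a, b} k) (tower_le le)) homotopy_equivalent_space sphere_sp (int k)"
proof -
  define \<phi> where "\<phi> x = (if x = Inl a then Inr (k, True) else if x = Inl b then Inr (k, False) else x)"
    for x :: "'a + nat \<times> bool"
  have "realization (tower {a, b} k) (tower_le le) homotopy_eqv
      realization (tower {} (Suc k) :: ('a + nat \<times> bool) set) (tower_le le)"
  proof (rule realization_iso)
    show "finite (tower {a, b} k)" by (simp add: finite_tower)
    show "bij_betw \<phi> (tower {a, b} k) (tower {} (Suc k))"
    proof (rule bij_betw_imageI)
      show "inj_on \<phi> (tower {a, b} k)" using assms(1) by (auto simp: inj_on_def \<phi>_def tower_def)
      show "\<phi> ` tower {a, b} k = tower {} (Suc k)"
      proof (intro equalityI subsetI)
        show "x \<in> tower {} (Suc k)" if "x \<in> \<phi> ` tower {a, b} k" for x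
          using that by (auto simp: \<phi>_def tower_def)
        fix x :: "'a + nat \<times> bool" assume "x \<in> tower {} (Suc k)"
        then obtain i s where x: "x = Inr (i, s)" "i \<le> k" by (auto simp: tower_def)
        consider "i < k" | "i = k" "s" | "i = k" "\<not> s" using x by linarith
        then show "x \<in> \<phi> ` tower {a, b} k"
        proof cases
          case 1
          then show ?thesis using x by (intro image_eqI[of _ _ x]) (auto simp: \<phi>_def tower_def)
        next
          case 2
          then show ?thesis using x by (intro image_eqI[of _ _ "Inl a"]) (auto simp: \<phi>_def tower_def)
        next
          case 3
          then show ?thesis using x assms(1) by (intro image_eqI[of _ _ "Inl b"]) (auto simp: \<phi>_def tower_def)
        qed
      qed
    qed
    fix x y assume "x \<in> tower {a, b} k" "y \<in> tower {a, b} k"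
    then show "tower_le le x y \<longleftrightarrow> tower_le le (\<phi> x) (\<phi> y)"
      using assms by (auto simp: \<phi>_def tower_def)
  qed
  then show ?thesis
    using tower_empty_sphere[of "Suc k" le] by (auto intro: homotopy_eqv_trans)
qed

lemma intv_memD:
  assumes "(i, j, e) \<in> intv p q (I, J, E)"
  shows "(e = 0 \<or> e = 1) \<and> i \<le> I \<and> j \<le> J \<and> (E < e \<longrightarrow> i + p \<le> I \<and> j + q \<le> J) \<and>
    (i, j, e) \<noteq> (0, 0, 0) \<and> (i, j, e) \<noteq> (I, J, E)"
  using assms by (auto simp: intv_def split: if_splits)

lemma intv_atom:
  assumes "w \<in> {(1, 0, 0), (0, 1, 0), (0, 0, 1)}" "1 \<le> p" "1 \<le> q"
  shows "intv p q w = {}"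
proof -
  have False if "(i, j, e) \<in> intv p q w" for i j e
  proof -
    consider "w = (1, 0, 0)" | "w = (0, 1, 0)" | "w = (0, 0, 1)" using assms by blast
    then show False
      using intv_memD[of i j e p q "fst w" "fst (snd w)" "snd (snd w)"] that assms(2,3)
      by cases (simp_all, linarith+)
  qed
  then show ?thesis by auto
qed

text \<open>An element containing c needs a second coordinate of at least \<open>q\<close> above it,
  so \<open>2 \<le> q\<close> keeps c out of the interval. For p = q = 1 it is the third
  point.\<close>

lemma intv_a_plus_b:
  assumes "2 \<le> q"
  shows "intv p q (1, 1, 0) = {(1, 0, 0), (0, 1, 0)}"
proof (intro equalityI subsetI)
  fix x assume x: "x \<in> intv p q (1, 1, 0)"
  obtain i j e where ije: "x = (i, j, e)" by (metis prod_cases3)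
  note m = intv_memD[OF x[unfolded ije]]
  have "e = 0" using m assms by linarith
  moreover have "i = 0 \<or> i = 1" "j = 0 \<or> j = 1" using m by linarith+
  ultimately show "x \<in> {(1, 0, 0), (0, 1, 0)}" using m ije by fastforce
qed (auto simp: intv_def)

lemma intv_a_plus_b_eq_2c: "intv 1 1 (1, 1, 0) = {(1, 0, 0), (0, 1, 0), (0, 0, 1)}"
proof (intro equalityI subsetI)
  fix x assume x: "x \<in> intv 1 1 (1, 1, 0)"
  obtain i j e where ije: "x = (i, j, e)" by (metis prod_cases3)
  note m = intv_memD[OF x[unfolded ije]]
  have "i = 0 \<or> i = 1" "j = 0 \<or> j = 1" "e = 0 \<or> e = 1" using m by linarith+
  then show "x \<in> {(1, 0, 0), (0, 1, 0), (0, 0, 1)}" using m ije by fastforce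
qed (auto simp: intv_def)

section \<open>The Frobenius complexes case by case\<close>

lemma frobenius_complex_pt:
  assumes "1 \<le> p" "1 \<le> q" "2 \<le> m \<and> n \<le> 1 \<or> m \<le> 1 \<and> 2 \<le> n" "m < p \<or> n < q"
  shows "frobenius_complex p q 2 (cls p q 2 (m, n, k)) homotopy_equivalent_space pt_space"
proof -
  have "frobenius_complex p q 2 (cls p q 2 (m, n, 0 + k)) homotopy_equivalent_space
      top_of_set (realization (tower (intv p q (nf p q (m, n, 0))) k) (tower_le (nle p q)))"
    using assms by (intro frobenius_complex_tower) auto
  moreover have "top_of_set (realization (tower (intv p q (m, n, 0)) k) (tower_le (nle p q)))
      homotopy_equivalent_space pt_space"
    using tower_contractible[OF assms(3,4), of k]
    by (intro homotopy_equivalent_pt_space) auto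
  ultimately show ?thesis by (auto intro: homotopy_eqv_trans)
qed

lemma frobenius_complex_unit:
  assumes "1 \<le> p" "1 \<le> q" "(m, n) = (1, 0) \<or> (m, n) = (0, 1)"
  shows "frobenius_complex p q 2 (cls p q 2 (m, n, k)) homotopy_equivalent_space sphere_sp (int k - 1)"
proof -
  have "frobenius_complex p q 2 (cls p q 2 (m, n, 0 + k)) homotopy_equivalent_space
      top_of_set (realization (tower (intv p q (nf p q (m, n, 0))) k) (tower_le (nle p q)))"
    using assms by (intro frobenius_complex_tower) auto
  moreover have "intv p q (nf p q (m, n, 0)) = {}"
    using assms intv_atom[of "(m, n, 0)" p q] by auto
  ultimately show ?thesis
    using tower_empty_sphere by (auto intro: homotopy_eqv_trans)
qed

lemma frobenius_complex_multiple_of_c: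
  assumes "1 \<le> p" "1 \<le> q" "1 \<le> k" "k = 1 \<or> \<not> (p = 1 \<and> q = 1)"
  shows "frobenius_complex p q 2 (cls p q 2 (0, 0, k)) homotopy_equivalent_space sphere_sp (int k - 2)"
proof -
  have "frobenius_complex p q 2 (cls p q 2 (0, 0, 1 + (k - 1))) homotopy_equivalent_space
      top_of_set (realization (tower (intv p q (nf p q (0, 0, 1))) (k - 1)) (tower_le (nle p q)))"
    using assms by (intro frobenius_complex_tower) auto
  moreover have "intv p q (nf p q (0, 0, 1)) = {}"
    using assms intv_atom[of "(0, 0, 1)" p q] by auto
  moreover have "int (k - 1) - 1 = int k - 2" using assms by simp
  ultimately show ?thesis
    using tower_empty_sphere[of "k - 1"] assms by (auto intro: homotopy_eqv_trans)
qed

lemma frobenius_complex_wedge: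
  assumes "2 \<le> k"
  shows "frobenius_complex 1 1 2 (cls 1 1 2 (0, 0, k)) homotopy_equivalent_space wedge_two_spheres (k - 2)"
proof -
  have 1: "frobenius_complex 1 1 2 (cls 1 1 2 (0, 0, 2 + (k - 2))) homotopy_equivalent_space
      top_of_set (realization (tower (intv 1 1 (nf 1 1 (0, 0, 2))) (k - 2)) (tower_le (nle 1 1)))"
    by (intro frobenius_complex_tower) auto
  have nf: "nf 1 1 (0, 0, 2) = (1, 1, 0)" and k: "2 + (k - 2) = k" using assms by auto
  have 2: "top_of_set (realization (tower {(1, 0, 0), (0, 1, 0), (0, 0, 1)} (k - 2)) (tower_le (nle 1 1)))
      homotopy_equivalent_space wedge_two_spheres (k - 2)"
    by (rule realization_tower_wedge) auto
  show ?thesis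
    by (rule homotopy_eqv_trans[OF 1[unfolded nf k intv_a_plus_b_eq_2c] 2])
qed

lemma frobenius_complex_a_plus_b:
  assumes "1 \<le> p" "2 \<le> q"
  shows "frobenius_complex p q 2 (cls p q 2 (1, 1, k)) homotopy_equivalent_space sphere_sp (int k)"
proof -
  have "frobenius_complex p q 2 (cls p q 2 (1, 1, 0 + k)) homotopy_equivalent_space
      top_of_set (realization (tower (intv p q (nf p q (1, 1, 0))) k) (tower_le (nle p q)))"
    using assms by (intro frobenius_complex_tower) auto
  moreover have "intv p q (nf p q (1, 1, 0)) = {(1, 0, 0), (0, 1, 0)}"
    using assms intv_a_plus_b by simp
  moreover have "top_of_set (realization (tower {(1, 0, 0), (0, 1, 0)} k) (tower_le (nle p q)))
      homotopy_equivalent_space sphere_sp (int k)"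
    by (intro tower_pair_sphere) auto
  ultimately show ?thesis by (auto intro: homotopy_eqv_trans)
qed

text \<open>One formula covers three ends of the descent: the empty base below c, the empty base
  below a or b, and the two points below a + b. Starting at c rather than at 0 uses up one c, which
  accounts for the dimension k - 2 when \<open>m\<close> and \<open>n\<close> are 0.\<close>

lemma frobenius_complex_sphere:
  assumes "1 \<le> p" "2 \<le> q" "m \<le> 1" "n \<le> 1" "(m, n, k) \<noteq> (0, 0, 0)"
  shows "frobenius_complex p q 2 (cls p q 2 (m, n, k)) homotopy_equivalent_space
    sphere_sp (int m + int n + int k - 2)"
proof -
  consider "m = 0" "n = 0" | "(m, n) = (1, 0) \<or> (m, n) = (0, 1)" | "m = 1" "n = 1"
    using assms by fastforce
  then show ?thesis
  proof cases
    case 1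
    then show ?thesis using frobenius_complex_multiple_of_c[of p q k] assms by simp
  next
    case 2
    moreover from this have "int m + int n + int k - 2 = int k - 1" by auto
    ultimately show ?thesis using frobenius_complex_unit[of p q m n k] assms by simp
  next
    case 3
    then show ?thesis using frobenius_complex_a_plus_b[of p q k] assms by simp
  qed
qed

theorem theorem3p5:
  shows
  "(\<forall>m n k :: nat. (m = 0 \<or> n = 0) \<and> cls 1 1 2 (m, n, k) \<noteq> cls 1 1 2 (0, 0, 0) \<longrightarrow>
      (if m = 0 \<and> n = 0 \<and> k = 1 then
         (frobenius_complex 1 1 2 (cls 1 1 2 (m, n, k))) homotopy_equivalent_space (sphere_sp (-1))
       else if m = 0 \<and> n = 0 \<and> k \<ge> 2 then
         (frobenius_complex 1 1 2 (cls 1 1 2 (m, n, k))) homotopy_equivalent_space (wedge_two_spheres (k - 2))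
       else if (m, n) = (1, 0) \<or> (m, n) = (0, 1) then
         (frobenius_complex 1 1 2 (cls 1 1 2 (m, n, k))) homotopy_equivalent_space (sphere_sp (int k - 1))
       else
         (frobenius_complex 1 1 2 (cls 1 1 2 (m, n, k))) homotopy_equivalent_space pt_space))
   \<and>
   (\<forall>m n k :: nat. (m = 0 \<or> n \<le> 1) \<and> cls 1 2 2 (m, n, k) \<noteq> cls 1 2 2 (0, 0, 0) \<longrightarrow>
      (if m \<le> 1 \<and> n \<le> 1 then
         (frobenius_complex 1 2 2 (cls 1 2 2 (m, n, k))) homotopy_equivalent_space (sphere_sp (int m + int n + int k - 2))
       else
         (frobenius_complex 1 2 2 (cls 1 2 2 (m, n, k))) homotopy_equivalent_space pt_space))
   \<and>
   (\<forall>m n k :: nat. (m \<le> 1 \<or> n \<le> 1) \<and> cls 2 2 2 (m, n, k) \<noteq> cls 2 2 2 (0, 0, 0) \<longrightarrow>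
      (if m \<le> 1 \<and> n \<le> 1 then
         (frobenius_complex 2 2 2 (cls 2 2 2 (m, n, k))) homotopy_equivalent_space (sphere_sp (int m + int n + int k - 2))
       else
         (frobenius_complex 2 2 2 (cls 2 2 2 (m, n, k))) homotopy_equivalent_space pt_space))"
proof (intro conjI allI impI)
  fix m n k :: nat
  assume A: "(m = 0 \<or> n = 0) \<and> cls 1 1 2 (m, n, k) \<noteq> cls 1 1 2 (0, 0, 0)"
  consider "m = 0" "n = 0" "k = 1" | "m = 0" "n = 0" "2 \<le> k" | "(m, n) = (1, 0) \<or> (m, n) = (0, 1)"
    | "2 \<le> m \<and> n = 0 \<or> m = 0 \<and> 2 \<le> n"
  proof -
    have "(m, n, k) \<noteq> (0, 0, 0)" using A by auto
    then have "m = 0 \<and> n = 0 \<and> k = 1 \<or> m = 0 \<and> n = 0 \<and> 2 \<le> k \<or> m = 1 \<and> n = 0 \<or> m = 0 \<and> n = 1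
        \<or> 2 \<le> m \<and> n = 0 \<or> m = 0 \<and> 2 \<le> n"
      using A by (simp; linarith)
    then show ?thesis using that by fastforce
  qed
  then show "if m = 0 \<and> n = 0 \<and> k = 1 then
         (frobenius_complex 1 1 2 (cls 1 1 2 (m, n, k))) homotopy_equivalent_space (sphere_sp (-1))
       else if m = 0 \<and> n = 0 \<and> k \<ge> 2 then
         (frobenius_complex 1 1 2 (cls 1 1 2 (m, n, k))) homotopy_equivalent_space (wedge_two_spheres (k - 2))
       else if (m, n) = (1, 0) \<or> (m, n) = (0, 1) then
         (frobenius_complex 1 1 2 (cls 1 1 2 (m, n, k))) homotopy_equivalent_space (sphere_sp (int k - 1))
       else
         (frobenius_complex 1 1 2 (cls 1 1 2 (m, n, k))) homotopy_equivalent_space pt_space"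
  proof cases
    case 1
    then show ?thesis using frobenius_complex_multiple_of_c[of 1 1 1] by simp
  next
    case 2
    then show ?thesis using frobenius_complex_wedge[of k] by simp
  next
    case 3
    then show ?thesis using frobenius_complex_unit[of 1 1 m n k] by auto
  next
    case 4
    then have "frobenius_complex 1 1 2 (cls 1 1 2 (m, n, k)) homotopy_equivalent_space pt_space"
      by (intro frobenius_complex_pt) auto
    then show ?thesis using 4 by auto
  qed
next
  fix m n k :: nat
  assume A: "(m = 0 \<or> n \<le> 1) \<and> cls 1 2 2 (m, n, k) \<noteq> cls 1 2 2 (0, 0, 0)"
  then have "(m, n, k) \<noteq> (0, 0, 0)" by auto
  then show "if m \<le> 1 \<and> n \<le> 1 then
         (frobenius_complex 1 2 2 (cls 1 2 2 (m, n, k))) homotopy_equivalent_space (sphere_sp (int m + int n + int k - 2))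
       else
         (frobenius_complex 1 2 2 (cls 1 2 2 (m, n, k))) homotopy_equivalent_space pt_space"
    using A frobenius_complex_sphere[of 1 2 m n k] frobenius_complex_pt[of 1 2 m n k]
    by (cases "m \<le> 1 \<and> n \<le> 1") (simp_all, linarith?)
next
  fix m n k :: nat
  assume A: "(m \<le> 1 \<or> n \<le> 1) \<and> cls 2 2 2 (m, n, k) \<noteq> cls 2 2 2 (0, 0, 0)"
  then have "(m, n, k) \<noteq> (0, 0, 0)" by auto
  then show "if m \<le> 1 \<and> n \<le> 1 then
         (frobenius_complex 2 2 2 (cls 2 2 2 (m, n, k))) homotopy_equivalent_space (sphere_sp (int m + int n + int k - 2))
       else
         (frobenius_complex 2 2 2 (cls 2 2 2 (m, n, k))) homotopy_equivalent_space pt_space"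
    using A frobenius_complex_sphere[of 2 2 m n k] frobenius_complex_pt[of 2 2 m n k]
    by (cases "m \<le> 1 \<and> n \<le> 1") (simp_all, linarith?)
qed

end
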